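(* There is a universal constant $c>0$ such that the following holds. For each fixed integer $k \ge 3$, if $\mathcal{A} \subset [k]^n$ is symmetric and intersecting, then $|\mathcal{A}| = O(k^n / n^{c/k})$; that is, for each integer $k\ge 3$ there is a constant $K_k>0$ such that for every positive integer $n$ and every symmetric intersecting family $\mathcal{A}\subset [k]^n$ one has $|\mathcal{A}| \le K_k\, k^n / n^{c/k}$.
   Context: For a positive integer $m$, $[m]=\{1,2,\dots,m\}$, and $[k]^n$ is the set of vectors $x=(x_1,\dots,x_n)$ with each $x_i\in[k]$. A family $\mathcal{A}\subset [k]^n$ is intersecting if any two of its elements agree on at least one coordinate, i.e., for all $x,y\in\mathcal{A}$ there is $i\in[n]$ with $x_i=y_i$. The symmetric group $S_n$ on $[n]$ acts on $[k]^n$ by $(\sigma(x))_i = x_{\sigma(i)}$ for $\sigma\in S_n$ and $x\in[k]^n$. The automorphism group of $\mathcal{A}\subset[k]^n$ is $\operatorname{Aut}(\mathcal{A})=\{\sigma\in S_n : \sigma(\mathcal{A})=\mathcal{A}\}$, and $\mathcal{A}$ is symmetric if $\operatorname{Aut}(\mathcal{A})$ is a transitive subgroup of $S_n$ (transitive in its action on $[n]$). *)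

theory Defs
  imports Complex_Main "HOL-Algebra.Sym_Groups" "HOL-Algebra.Group_Action"
begin

text \<open>Vectors in \<open>[k]\<^sup>n\<close> are extensional functions, so that equality of vectors is equality
  of the \<open>n\<close> coordinates and cardinalities of families are the intended ones.\<close>

definition grid :: "nat \<Rightarrow> nat \<Rightarrow> (nat \<Rightarrow> nat) set" where
  "grid k n = {1..n} \<rightarrow>\<^sub>E {1..k}"

definition intersecting :: "nat \<Rightarrow> (nat \<Rightarrow> nat) set \<Rightarrow> bool" where
  "intersecting n A \<longleftrightarrow> (\<forall>x\<in>A. \<forall>y\<in>A. \<exists>i\<in>{1..n}. x i = y i)"

text \<open>\<open>(\<sigma>(x))\<^sub>i = x\<^bsub>\<sigma>(i)\<^esub>\<close>. A permutation of \<open>{1..n}\<close> fixes everything outside \<open>{1..n}\<close>, so no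
  restriction is needed for the result to be extensional.\<close>

definition perm_vec :: "(nat \<Rightarrow> nat) \<Rightarrow> (nat \<Rightarrow> nat) \<Rightarrow> (nat \<Rightarrow> nat)" where
  "perm_vec \<sigma> x = (\<lambda>i. x (\<sigma> i))"

definition family_Aut :: "nat \<Rightarrow> (nat \<Rightarrow> nat) set \<Rightarrow> (nat \<Rightarrow> nat) set" where
  "family_Aut n A = {\<sigma> \<in> carrier (sym_group n). perm_vec \<sigma> ` A = A}"

text \<open>Group actions on a set are homomorphisms into its group of extensional bijections, which
  is why the natural action of permutations is written with \<open>restrict\<close>.\<close>

definition transitive_subgroup :: "nat \<Rightarrow> (nat \<Rightarrow> nat) set \<Rightarrow> bool" where
  "transitive_subgroup n H \<longleftrightarrow> subgroup H (sym_group n) \<and>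
     transitive_action (sym_group n\<lparr>carrier := H\<rparr>) {1..n} (\<lambda>\<sigma>. restrict \<sigma> {1..n})"

definition symmetric_family :: "nat \<Rightarrow> (nat \<Rightarrow> nat) set \<Rightarrow> bool" where
  "symmetric_family n A \<longleftrightarrow> transitive_subgroup n (family_Aut n A)"

lemma perm_vec_grid:
  assumes "\<sigma> permutes {1..n}" "x \<in> grid k n"
  shows "perm_vec \<sigma> x \<in> grid k n"
proof (unfold grid_def, rule PiE_I)
  fix i assume "i \<in> {1..n}"
  then have "\<sigma> i \<in> {1..n}" using assms(1) by (metis permutes_in_image)
  then show "perm_vec \<sigma> x i \<in> {1..k}"
    using assms(2) unfolding grid_def perm_vec_def by (rule PiE_mem[rotated])
next
  fix i assume "i \<notin> {1..n}"
  moreover from this have "\<sigma> i = i" using assms(1) by (metis permutes_not_in)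
  ultimately show "perm_vec \<sigma> x i = undefined"
    using assms(2) PiE_arb unfolding grid_def perm_vec_def by metis
qed

lemma family_Aut_subgroup: "subgroup (family_Aut n A) (sym_group n)"
proof (rule group.subgroupI[OF sym_group_is_group])
  show "family_Aut n A \<subseteq> carrier (sym_group n)"
    by (auto simp: family_Aut_def)
  have "id \<in> family_Aut n A"
    by (simp add: family_Aut_def sym_group_def permutes_id perm_vec_def)
  then show "family_Aut n A \<noteq> {}" by blast
next
  fix s assume s: "s \<in> family_Aut n A"
  then have p: "s permutes {1..n}" and im: "perm_vec s ` A = A"
    by (auto simp: family_Aut_def sym_group_def)
  have inv_eq: "inv\<^bsub>sym_group n\<^esub> s = inv' s"
  proof (rule group.inv_equality[OF sym_group_is_group])
    show "inv' s \<otimes>\<^bsub>sym_group n\<^esub> s = \<one>\<^bsub>sym_group n\<^esub>"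
      using permutes_inv_o(2)[OF p] by (simp add: sym_group_def)
  qed (use p permutes_inv[OF p] in \<open>auto simp: sym_group_def\<close>)
  have "perm_vec (inv' s) ` (perm_vec s ` A) = A"
    using permutes_inverses(1)[OF p] by (simp add: image_image perm_vec_def)
  then have "perm_vec (inv' s) ` A = A" using im by simp
  then show "inv\<^bsub>sym_group n\<^esub> s \<in> family_Aut n A"
    using permutes_inv[OF p] unfolding inv_eq by (simp add: family_Aut_def sym_group_carrier)
next
  fix s t assume "s \<in> family_Aut n A" "t \<in> family_Aut n A"
  then have p: "s permutes {1..n}" "t permutes {1..n}"
    and im: "perm_vec s ` A = A" "perm_vec t ` A = A"
    by (auto simp: family_Aut_def sym_group_def)
  have "perm_vec (s \<circ> t) ` A = perm_vec t ` (perm_vec s ` A)"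
    by (simp add: image_image perm_vec_def)
  then have "perm_vec (s \<circ> t) ` A = A"
    by (simp only: im)
  then show "s \<otimes>\<^bsub>sym_group n\<^esub> t \<in> family_Aut n A"
    using permutes_compose[OF p(2,1)] by (simp add: family_Aut_def sym_group_def)
qed

lemma transitive_subgroup_iff:
  "transitive_subgroup n H \<longleftrightarrow> subgroup H (sym_group n) \<and>
     (\<forall>i\<in>{1..n}. \<forall>j\<in>{1..n}. \<exists>\<sigma>\<in>H. \<sigma> i = j)"
proof (cases "subgroup H (sym_group n)")
  case True
  let ?G = "sym_group n\<lparr>carrier := H\<rparr>" and ?\<phi> = "\<lambda>\<sigma>. restrict \<sigma> {1..n}"
  have perm: "\<sigma> permutes {1..n}" if "\<sigma> \<in> H" for \<sigma>
    using subgroup.mem_carrier[OF True that] by (simp add: sym_group_def)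
  have bij: "?\<phi> \<sigma> \<in> Bij {1..n}" if "\<sigma> \<in> H" for \<sigma>
    using permutes_imp_bij[OF perm[OF that]] by (simp add: Bij_def)
  have "?\<phi> \<in> hom ?G (BijGroup {1..n})"
  proof (rule homI)
    fix s t assume st: "s \<in> carrier ?G" "t \<in> carrier ?G"
    then have "\<And>i. i \<in> {1..n} \<Longrightarrow> t i \<in> {1..n}"
      using permutes_in_image[OF perm] by simp
    then show "?\<phi> (s \<otimes>\<^bsub>?G\<^esub> t) = ?\<phi> s \<otimes>\<^bsub>BijGroup {1..n}\<^esub> ?\<phi> t"
      using st bij by (auto simp: BijGroup_def sym_group_def compose_def restrict_def fun_eq_iff)
  next
    fix s assume "s \<in> carrier ?G"
    then show "?\<phi> s \<in> carrier (BijGroup {1..n})"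
      using bij[of s] unfolding BijGroup_def by simp
  qed
  then have "group_action ?G {1..n} ?\<phi>"
    using subgroup.subgroup_is_group[OF True sym_group_is_group] group_BijGroup
    unfolding group_action_def group_hom_def group_hom_axioms_def by blast
  then have "transitive_action ?G {1..n} ?\<phi> \<longleftrightarrow>
      (\<forall>i j. i \<in> {1..n} \<longrightarrow> j \<in> {1..n} \<longrightarrow> (\<exists>\<sigma>\<in>H. ?\<phi> \<sigma> i = j))"
    unfolding transitive_action_def transitive_action_axioms_def by simp
  also have "\<dots> \<longleftrightarrow> (\<forall>i\<in>{1..n}. \<forall>j\<in>{1..n}. \<exists>\<sigma>\<in>H. \<sigma> i = j)"
    unfolding Ball_def by (metis (no_types, lifting) restrict_apply')
  finally show ?thesis
    using True unfolding transitive_subgroup_def by blast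
qed (simp add: transitive_subgroup_def)

lemma symmetric_family_iff:
  "symmetric_family n A \<longleftrightarrow> (\<forall>i\<in>{1..n}. \<forall>j\<in>{1..n}. \<exists>\<sigma>\<in>family_Aut n A. \<sigma> i = j)"
  by (simp add: symmetric_family_def transitive_subgroup_iff family_Aut_subgroup)

end

theory Submission
  imports Defs
begin

text \<open>Let \<open>S\<^sub>1, \<dots>, S\<^sub>n\<close> be independent random subsets of \<open>[k]\<close>, each a uniform singleton with
  probability \<open>1 - t\<close> and the complement of a uniform singleton with probability \<open>t\<close>, and let \<open>F t\<close>
  be the probability that \<open>S\<^sub>1 \<times> \<dots> \<times> S\<^sub>n\<close> meets \<open>A\<close>. Then \<open>F 0 = |A| / k^n\<close>, and
  \<open>F (1/2) \<le> 1/2\<close> because at \<open>t = 1/2\<close> the law is invariant under complementation while an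
  intersecting family cannot meet both a box and its coordinatewise complement. The meeting event
  is monotone, so for \<open>k \<ge> 3\<close> the derivative \<open>F' t\<close> dominates the total influence \<open>J\<close>, the sum
  over the coordinates of the expected conditional variances. By symmetry all influences are
  equal, and the argument of Falik and Samorodnitsky (entropy of martingale differences and a
  logarithmic Sobolev inequality with constant of order \<open>k\<close>) gives \<open>J \<ge> F (1 - F) ln n / (16 k)\<close>
  for \<open>t\<close> between \<open>1/4\<close> and \<open>1/2\<close>. Integrating \<open>F' \<ge> F ln n / (32 k)\<close> over this interval bounds
  \<open>F (1/4) \<ge> F 0\<close> by \<open>n powr (- 1 / (128 k))\<close>.\<close>

section \<open>Entropy on a finite probability space\<close>

text \<open>Nonnegativity of relative entropy, with \<open>X\<close> and \<open>Y\<close> as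
  densities normalised by their \<open>w\<close>-sums. The last hypothesis is absolute continuity,
  which disarms the points where \<open>Y\<close> vanishes.\<close>

lemma sum_gibbs:
  fixes w X Y :: "'a \<Rightarrow> real"
  assumes "finite S" and w: "\<And>a. a \<in> S \<Longrightarrow> 0 < w a"
    and X: "\<And>a. a \<in> S \<Longrightarrow> 0 \<le> X a" and Y: "\<And>a. a \<in> S \<Longrightarrow> 0 \<le> Y a"
    and XY: "\<And>a. a \<in> S \<Longrightarrow> Y a = 0 \<Longrightarrow> X a = 0"
  shows "(\<Sum>a\<in>S. w a * (X a * (ln (Y a) - ln (\<Sum>b\<in>S. w b * Y b))))
      \<le> (\<Sum>a\<in>S. w a * (X a * ln (X a))) - (\<Sum>a\<in>S. w a * X a) * ln (\<Sum>a\<in>S. w a * X a)"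
proof -
  define mX where "mX = (\<Sum>a\<in>S. w a * X a)"
  define mY where "mY = (\<Sum>a\<in>S. w a * Y a)"
  show ?thesis
  proof (cases "\<forall>a\<in>S. X a = 0")
    case True
    then show ?thesis by simp
  next
    case False
    then obtain a0 where a0: "a0 \<in> S" "X a0 \<noteq> 0" by blast
    have "0 < w a0 * X a0" "0 < w a0 * Y a0"
      using a0 w[of a0] X[of a0] Y[of a0] XY[of a0] by (auto simp: less_le)
    then have pos: "0 < mX" "0 < mY"
      unfolding mX_def mY_def using a0 w X Y \<open>finite S\<close>
      by (auto intro!: sum_pos2[of _ a0] mult_nonneg_nonneg simp: less_imp_le)
    \<comment> \<open>This is \<open>ln x \<le> x - 1\<close> at the quotient of the two normalised
      densities; the left side is arranged to sum to zero.\<close>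
    have "w a * X a - w a * Y a * (mX / mY)
        \<le> w a * (X a * ln (X a)) - w a * X a * ln mX - w a * (X a * (ln (Y a) - ln mY))"
      if a: "a \<in> S" for a
    proof (cases "X a = 0")
      case True
      then show ?thesis using w[OF a] Y[OF a] pos by simp
    next
      case False
      then have p: "0 < X a" "0 < Y a" using X[OF a] Y[OF a] XY[OF a] by (auto simp: less_le)
      have "ln (Y a * mX / (X a * mY)) \<le> Y a * mX / (X a * mY) - 1"
        using p pos by (intro ln_le_minus_one) simp
      then have "1 - Y a * mX / (X a * mY) \<le> ln (X a) + ln mY - ln (Y a) - ln mX"
        using p pos by (simp add: ln_div ln_mult)
      then have "w a * X a * (1 - Y a * mX / (X a * mY))
          \<le> w a * X a * (ln (X a) + ln mY - ln (Y a) - ln mX)"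
        using p w[OF a] by (intro mult_left_mono) auto
      moreover have "w a * X a * (1 - Y a * mX / (X a * mY)) = w a * X a - w a * Y a * (mX / mY)"
        using p pos by (simp add: field_simps)
      ultimately show ?thesis by (simp add: algebra_simps)
    qed
    then have "(\<Sum>a\<in>S. w a * X a - w a * Y a * (mX / mY)) \<le>
        (\<Sum>a\<in>S. w a * (X a * ln (X a)) - w a * X a * ln mX - w a * (X a * (ln (Y a) - ln mY)))"
      by (rule sum_mono)
    moreover have "(\<Sum>a\<in>S. w a * X a - w a * Y a * (mX / mY)) = 0"
    proof -
      have "(\<Sum>a\<in>S. w a * X a - w a * Y a * (mX / mY)) = mX - mY * (mX / mY)"
        unfolding sum_subtractf mX_def mY_def sum_distrib_right ..
      then show ?thesis using pos by simp
    qed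
    ultimately show ?thesis
      by (simp add: sum_subtractf mX_def mY_def flip: sum_distrib_right)
  qed
qed

text \<open>Only \<open>ln x \<le> x - 1\<close> is used, which bounds the entropy of \<open>g\<^sup>2\<close> by the variance of
  \<open>g\<^sup>2\<close> over its mean; the order \<open>1/\<alpha>\<close> of the constant is not optimal.\<close>

lemma sum_log_sobolev:
  fixes w g :: "'a \<Rightarrow> real"
  assumes "finite S" and w: "\<And>a. a \<in> S \<Longrightarrow> \<alpha> \<le> w a" and w1: "sum w S = 1"
    and \<alpha>: "0 < \<alpha>" "\<alpha> \<le> 1/4"
  defines "m \<equiv> \<Sum>a\<in>S. w a * g a"
  shows "(\<Sum>a\<in>S. w a * ((g a)\<^sup>2 * ln ((g a)\<^sup>2)))
      - (\<Sum>a\<in>S. w a * (g a)\<^sup>2) * ln (\<Sum>a\<in>S. w a * (g a)\<^sup>2)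
    \<le> 2 / \<alpha> * (\<Sum>a\<in>S. w a * (g a - m)\<^sup>2)"
proof -
  define q where "q = (\<Sum>a\<in>S. w a * (g a)\<^sup>2)"
  define v where "v = (\<Sum>a\<in>S. w a * (g a - m)\<^sup>2)"
  have w0: "0 < w a" if "a \<in> S" for a using w[OF that] \<alpha> by simp
  have v0: "0 \<le> v" unfolding v_def using w0 by (auto intro!: sum_nonneg simp: less_imp_le)
  have v_eq: "v = q - m\<^sup>2"
  proof -
    have "v = (\<Sum>a\<in>S. w a * (g a)\<^sup>2 - 2 * m * (w a * g a) + m\<^sup>2 * w a)"
      unfolding v_def by (intro sum.cong) (auto simp: power2_eq_square algebra_simps)
    also have "\<dots> = q - 2 * m * m + m\<^sup>2 * 1"
      unfolding q_def m_def w1[symmetric] by (simp add: sum.distrib sum_subtractf sum_distrib_left)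
    finally show ?thesis by (simp add: power2_eq_square)
  qed
  show ?thesis
  proof (cases "q = 0")
    case True
    then have "\<forall>a\<in>S. w a * (g a)\<^sup>2 = 0"
      unfolding q_def using w0 \<open>finite S\<close> by (subst (asm) sum_nonneg_eq_0_iff) (auto simp: less_imp_le)
    then have "\<forall>a\<in>S. g a = 0" using w0 by force
    then show ?thesis using \<alpha> v0 by (simp add: v_def)
  next
    case False
    have "0 \<le> q" unfolding q_def using w0 by (auto intro!: sum_nonneg simp: less_imp_le)
    with False have q: "0 < q" by simp
    have pt: "w a * ((g a)\<^sup>2 * ln ((g a)\<^sup>2)) - w a * (g a)\<^sup>2 * ln q
        \<le> w a * ((g a)\<^sup>2 * ((g a)\<^sup>2 / q - 1))" if a: "a \<in> S" for a
    proof (cases "g a = 0")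
      case False
      then have "ln ((g a)\<^sup>2 / q) \<le> (g a)\<^sup>2 / q - 1"
        using q by (intro ln_le_minus_one) simp
      then have "ln ((g a)\<^sup>2) - ln q \<le> (g a)\<^sup>2 / q - 1"
        using False q by (simp add: ln_div)
      then have "w a * (g a)\<^sup>2 * (ln ((g a)\<^sup>2) - ln q) \<le> w a * (g a)\<^sup>2 * ((g a)\<^sup>2 / q - 1)"
        using w0[OF a] by (intro mult_left_mono) auto
      then show ?thesis by (simp add: algebra_simps)
    qed simp
    \<comment> \<open>The fourth moment is expanded around \<open>m^2\<close>. Every atom weighs at
      least \<open>\<alpha>\<close>, so the deviation \<open>h\<close> satisfies
      \<open>h^2 \<le> v / \<alpha>\<close> pointwise, which reduces its fourth power to its
      square.\<close>
    have sq: "w a * ((g a)\<^sup>2 * (g a)\<^sup>2) \<le> w a * (g a)\<^sup>2 * (2 * m\<^sup>2) - w a * m ^ 4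
        + (8 * m\<^sup>2 + 2 * v / \<alpha>) * (w a * (g a - m)\<^sup>2)" if a: "a \<in> S" for a
    proof -
      define h where "h = g a - m"
      have "\<alpha> * h\<^sup>2 \<le> w a * h\<^sup>2" using w[OF a] by (intro mult_right_mono) auto
      also have "\<dots> \<le> v" unfolding v_def h_def using \<open>finite S\<close> w0 a
        by (intro member_le_sum) (auto simp: less_imp_le)
      finally have "h\<^sup>2 \<le> v / \<alpha>" using \<alpha> by (simp add: field_simps)
      then have "2 * h\<^sup>2 * h\<^sup>2 \<le> 2 * (v / \<alpha>) * h\<^sup>2" by (intro mult_right_mono) auto
      moreover have "((g a)\<^sup>2 - m\<^sup>2)\<^sup>2 \<le> 8 * m\<^sup>2 * h\<^sup>2 + 2 * h\<^sup>2 * h\<^sup>2"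
      proof -
        have "0 \<le> (2 * m * h - h\<^sup>2)\<^sup>2" by simp
        moreover have "(g a)\<^sup>2 - m\<^sup>2 = 2 * m * h + h\<^sup>2"
          unfolding h_def by (simp add: power2_eq_square algebra_simps)
        ultimately show ?thesis by (simp add: power2_eq_square algebra_simps)
      qed
      ultimately have "((g a)\<^sup>2 - m\<^sup>2)\<^sup>2 \<le> (8 * m\<^sup>2 + 2 * v / \<alpha>) * h\<^sup>2"
        by (simp add: algebra_simps)
      then have "w a * ((g a)\<^sup>2 - m\<^sup>2)\<^sup>2 \<le> w a * ((8 * m\<^sup>2 + 2 * v / \<alpha>) * h\<^sup>2)"
        using w0[OF a] by (intro mult_left_mono) auto
      moreover have "w a * ((g a)\<^sup>2 - m\<^sup>2)\<^sup>2 =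
          w a * ((g a)\<^sup>2 * (g a)\<^sup>2) - w a * (g a)\<^sup>2 * (2 * m\<^sup>2) + w a * m ^ 4"
        by (simp add: power2_eq_square power4_eq_xxxx algebra_simps)
      ultimately show ?thesis by (simp add: h_def algebra_simps)
    qed
    have "(\<Sum>a\<in>S. w a * ((g a)\<^sup>2 * (g a)\<^sup>2))
        \<le> (\<Sum>a\<in>S. w a * (g a)\<^sup>2 * (2 * m\<^sup>2) - w a * m ^ 4
          + (8 * m\<^sup>2 + 2 * v / \<alpha>) * (w a * (g a - m)\<^sup>2))"
      by (intro sum_mono sq)
    also have "\<dots> = q * (2 * m\<^sup>2) - 1 * m ^ 4 + (8 * m\<^sup>2 + 2 * v / \<alpha>) * v"
      unfolding q_def v_def w1[symmetric]
      by (simp add: sum.distrib sum_subtractf sum_distrib_right sum_distrib_left)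
    also have "\<dots> \<le> q\<^sup>2 + (8 * m\<^sup>2 + 2 * v / \<alpha>) * v"
    proof -
      have "0 \<le> (q - m\<^sup>2)\<^sup>2" by simp
      then show ?thesis by (simp add: power2_eq_square power4_eq_xxxx algebra_simps)
    qed
    \<comment> \<open>Here \<open>\<alpha> \<le> 1/4\<close> enters:
      \<open>8 \<le> 2 / \<alpha>\<close> lets \<open>m^2 + v = q\<close> absorb both terms.\<close>
    also have "\<dots> \<le> q\<^sup>2 + (2 / \<alpha> * q) * v"
    proof -
      have "8 \<le> 2 / \<alpha>" using \<alpha> by (simp add: field_simps)
      then have "8 * m\<^sup>2 \<le> 2 / \<alpha> * m\<^sup>2" by (intro mult_right_mono) auto
      then have "8 * m\<^sup>2 + 2 * v / \<alpha> \<le> 2 / \<alpha> * q" unfolding v_eq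
        by (simp add: right_diff_distrib diff_divide_distrib algebra_simps)
      then show ?thesis using v0 by (intro add_left_mono mult_right_mono) auto
    qed
    finally have fourth: "(\<Sum>a\<in>S. w a * ((g a)\<^sup>2 * (g a)\<^sup>2)) / q \<le> q + 2 / \<alpha> * v"
      using q by (simp add: field_simps power2_eq_square)
    have "(\<Sum>a\<in>S. w a * ((g a)\<^sup>2 * ln ((g a)\<^sup>2))) - q * ln q
        = (\<Sum>a\<in>S. w a * ((g a)\<^sup>2 * ln ((g a)\<^sup>2)) - w a * (g a)\<^sup>2 * ln q)"
      unfolding q_def by (simp add: sum_subtractf sum_distrib_right)
    also have "\<dots> \<le> (\<Sum>a\<in>S. w a * ((g a)\<^sup>2 * ((g a)\<^sup>2 / q - 1)))"
      by (intro sum_mono pt)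
    also have "\<dots> = (\<Sum>a\<in>S. w a * ((g a)\<^sup>2 * (g a)\<^sup>2)) / q - q"
      unfolding q_def by (simp add: sum_subtractf sum_divide_distrib right_diff_distrib)
    also have "\<dots> \<le> 2 / \<alpha> * v" using fourth by simp
    finally show ?thesis unfolding q_def v_def .
  qed
qed

section \<open>Averaging operators on product spaces\<close>

text \<open>For probability weights this is conditional expectation given the other coordinates.
  Weights of any sign are allowed, because derivatives of weights are inserted later.\<close>

definition coord_avg :: "('a \<Rightarrow> real) \<Rightarrow> 'a set \<Rightarrow> nat \<Rightarrow> ((nat \<Rightarrow> 'a) \<Rightarrow> real) \<Rightarrow> (nat \<Rightarrow> 'a) \<Rightarrow> real"
  where "coord_avg w S i f = (\<lambda>x. \<Sum>a\<in>S. w a * f (x(i := a)))"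

text \<open>The result stays a function of the whole vector, so that partial averages over the first
  coordinates form a martingale.\<close>

fun prod_avg :: "('a \<Rightarrow> real) \<Rightarrow> 'a set \<Rightarrow> nat \<Rightarrow> ((nat \<Rightarrow> 'a) \<Rightarrow> real) \<Rightarrow> (nat \<Rightarrow> 'a) \<Rightarrow> real" where
  "prod_avg w S 0 f = f"
| "prod_avg w S (Suc n) f = coord_avg w S (Suc n) (prod_avg w S n f)"

definition coord_indep :: "nat \<Rightarrow> ((nat \<Rightarrow> 'a) \<Rightarrow> 'b) \<Rightarrow> bool" where
  "coord_indep i f \<longleftrightarrow> (\<forall>x a. f (x(i := a)) = f x)"

lemma coord_avg_add:
  "coord_avg w S i (\<lambda>x. f x + g x) = (\<lambda>x. coord_avg w S i f x + coord_avg w S i g x)"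
  by (simp add: coord_avg_def sum.distrib distrib_left)

lemma coord_avg_diff:
  "coord_avg w S i (\<lambda>x. f x - g x) = (\<lambda>x. coord_avg w S i f x - coord_avg w S i g x)"
  by (simp add: coord_avg_def sum_subtractf right_diff_distrib)

lemma coord_avg_cmult:
  "coord_avg w S i (\<lambda>x. c * f x) = (\<lambda>x. c * coord_avg w S i f x)"
  by (simp add: coord_avg_def sum_distrib_left mult.left_commute)

lemma coord_avg_commute:
  assumes "i \<noteq> j"
  shows "coord_avg w S i (coord_avg v S j f) = coord_avg v S j (coord_avg w S i f)"
proof
  fix x
  show "coord_avg w S i (coord_avg v S j f) x = coord_avg v S j (coord_avg w S i f) x"
    using assms by (simp add: coord_avg_def sum_distrib_left mult.left_commute fun_upd_twist)
      (subst sum.swap, simp)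
qed

lemma coord_indep_avg: "coord_indep i (coord_avg w S i f)"
  by (simp add: coord_indep_def coord_avg_def)

lemma coord_indep_avg_other: "coord_indep i f \<Longrightarrow> coord_indep i (coord_avg w S j f)"
  by (cases "i = j") (simp_all add: coord_indep_def coord_avg_def fun_upd_twist[of i j])

lemma coord_avg_mult_indep:
  assumes "coord_indep i f"
  shows "coord_avg w S i (\<lambda>x. f x * g x) = (\<lambda>x. f x * coord_avg w S i g x)"
  using assms by (simp add: coord_avg_def coord_indep_def sum_distrib_left mult.left_commute)

lemma prod_avg_add:
  "prod_avg w S n (\<lambda>x. f x + g x) = (\<lambda>x. prod_avg w S n f x + prod_avg w S n g x)"
  by (induction n) (simp_all add: coord_avg_add)

lemma prod_avg_diff:
  "prod_avg w S n (\<lambda>x. f x - g x) = (\<lambda>x. prod_avg w S n f x - prod_avg w S n g x)"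
  by (induction n) (simp_all add: coord_avg_diff)

lemma prod_avg_cmult:
  "prod_avg w S n (\<lambda>x. c * f x) = (\<lambda>x. c * prod_avg w S n f x)"
  by (induction n) (simp_all add: coord_avg_cmult)

lemma prod_avg_sum:
  "prod_avg w S n (\<lambda>x. \<Sum>i\<in>I. f i x) = (\<lambda>x. \<Sum>i\<in>I. prod_avg w S n (f i) x)"
proof (induction I rule: infinite_finite_induct)
  case (insert i I)
  then show ?case by (simp add: prod_avg_add)
qed (use prod_avg_cmult[of w S n 0 "\<lambda>_. 0"] in simp_all)

text \<open>The second weight \<open>v\<close> is independent of \<open>w\<close>: differentiation
  replaces the weight at one coordinate only.\<close>

lemma prod_avg_coord_commute:
  assumes "n < i"
  shows "prod_avg w S n (coord_avg v S i f) = coord_avg v S i (prod_avg w S n f)"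
  using assms by (induction n) (simp_all add: coord_avg_commute)

lemma prod_avg_coord_commute':
  "prod_avg w S n (coord_avg w S i f) = coord_avg w S i (prod_avg w S n f)"
proof (induction n)
  case (Suc n)
  then show ?case by (cases "i = Suc n") (simp_all add: coord_avg_commute)
qed simp

lemma coord_indep_prod_avg_le: "i \<in> {1..n} \<Longrightarrow> coord_indep i (prod_avg w S n f)"
  by (induction n) (auto simp: coord_indep_avg coord_indep_avg_other le_Suc_eq)

lemma prod_avg_mult_indep:
  assumes "\<And>i. i \<in> {1..n} \<Longrightarrow> coord_indep i f"
  shows "prod_avg w S n (\<lambda>x. f x * g x) = (\<lambda>x. f x * prod_avg w S n g x)"
  using assms by (induction n) (simp_all add: coord_avg_mult_indep)

text \<open>Fubini for the iterated average, by splitting off the last coordinate. The explicit sum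
  serves arguments that treat all coordinates at once: monotonicity, permutations and
  counting.\<close>

lemma prod_avg_eq_sum:
  assumes "finite S"
  shows "prod_avg w S n f x =
    (\<Sum>y\<in>{1..n} \<rightarrow>\<^sub>E S. (\<Prod>i\<in>{1..n}. w (y i)) * f (override_on x y {1..n}))"
proof (induction n arbitrary: x)
  case 0
  then show ?case by simp
next
  case (Suc n)
  have inj: "inj_on (\<lambda>(y, g). g(Suc n := y)) (S \<times> ({1..n} \<rightarrow>\<^sub>E S))"
    using inj_combinator[of "Suc n" "{1..n}" "\<lambda>_. S"] by simp
  have ov: "override_on x (y(Suc n := a)) {1..Suc n}
      = override_on (x(Suc n := a)) y {1..n}" for y a
    by (auto simp: override_on_def)
  have PiE_Suc: "{1..Suc n} \<rightarrow>\<^sub>E S = (\<lambda>(y, g). g(Suc n := y)) ` (S \<times> ({1..n} \<rightarrow>\<^sub>E S))"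
    using PiE_insert_eq[of "Suc n" "{1..n}" "\<lambda>_. S"] by (simp add: atLeastAtMostSuc_conv)
  have "(\<Sum>y\<in>{1..Suc n} \<rightarrow>\<^sub>E S. (\<Prod>i\<in>{1..Suc n}. w (y i)) * f (override_on x y {1..Suc n}))
     = (\<Sum>(a, y)\<in>S \<times> ({1..n} \<rightarrow>\<^sub>E S). (\<Prod>i\<in>{1..Suc n}. w ((y(Suc n := a)) i))
          * f (override_on x (y(Suc n := a)) {1..Suc n}))"
    unfolding PiE_Suc by (subst sum.reindex[OF inj]) (simp add: case_prod_unfold o_def)
  also have "\<dots> = (\<Sum>(a, y)\<in>S \<times> ({1..n} \<rightarrow>\<^sub>E S). w a * ((\<Prod>i\<in>{1..n}. w (y i))
          * f (override_on (x(Suc n := a)) y {1..n})))"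
  proof (intro sum.cong refl, clarify)
    fix a y
    have "(\<Prod>i\<in>{1..n}. w (if i = Suc n then a else y i)) = (\<Prod>i\<in>{1..n}. w (y i))"
      by (intro prod.cong) auto
    then show "(\<Prod>i\<in>{1..Suc n}. w ((y(Suc n := a)) i)) * f (override_on x (y(Suc n := a)) {1..Suc n})
      = w a * ((\<Prod>i\<in>{1..n}. w (y i)) * f (override_on (x(Suc n := a)) y {1..n}))"
      unfolding ov by (simp add: atLeastAtMostSuc_conv mult.assoc)
  qed
  also have "\<dots> = prod_avg w S (Suc n) f x"
    by (simp add: coord_avg_def Suc sum_distrib_left sum.cartesian_product fun_upd_def)
  finally show ?case by simp
qed

lemma prod_avg_mono:
  assumes "finite S" "\<And>a. a \<in> S \<Longrightarrow> 0 \<le> w a"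
    and "\<And>y. (\<And>i. i \<in> {1..n} \<Longrightarrow> y i \<in> S) \<Longrightarrow> f y \<le> g y"
  shows "prod_avg w S n f x \<le> prod_avg w S n g x"
  unfolding prod_avg_eq_sum[OF assms(1)]
  by (intro sum_mono mult_left_mono assms(3) prod_nonneg ballI assms(2))
    (auto simp: override_on_def)

text \<open>All coordinates carry the same weights, so the product law is invariant under reindexing
  by \<open>\<sigma>\<close>.\<close>

lemma prod_avg_permutes:
  assumes S: "finite S" and \<sigma>: "\<sigma> permutes {1..n}"
    and f: "\<And>y z. (\<And>i. i \<in> {1..n} \<Longrightarrow> y i = z i) \<Longrightarrow> f y = f z"
  shows "prod_avg w S n (\<lambda>x. f (x \<circ> \<sigma>)) x = prod_avg w S n f x"
proof -
  have \<sigma>i: "\<sigma> i \<in> {1..n} \<longleftrightarrow> i \<in> {1..n}" for i using \<sigma> by (rule permutes_in_image)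
  have "bij_betw (\<lambda>y. y \<circ> \<sigma>) ({1..n} \<rightarrow>\<^sub>E S) ({1..n} \<rightarrow>\<^sub>E S)"
  proof (rule bij_betwI[where g = "\<lambda>y. y \<circ> inv' \<sigma>"])
    have \<tau>i: "inv' \<sigma> i \<in> {1..n} \<longleftrightarrow> i \<in> {1..n}" for i
      using permutes_in_image[OF permutes_inv[OF \<sigma>]] .
    show "(\<lambda>y. y \<circ> \<sigma>) \<in> ({1..n} \<rightarrow>\<^sub>E S) \<rightarrow> {1..n} \<rightarrow>\<^sub>E S"
      using \<sigma>i by (auto simp: PiE_iff extensional_def simp del: atLeastAtMost_iff)
    show "(\<lambda>y. y \<circ> inv' \<sigma>) \<in> ({1..n} \<rightarrow>\<^sub>E S) \<rightarrow> {1..n} \<rightarrow>\<^sub>E S"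
      using \<tau>i by (auto simp: PiE_iff extensional_def simp del: atLeastAtMost_iff)
  qed (use permutes_inv_o[OF \<sigma>] in \<open>simp_all add: o_assoc[symmetric]\<close>)
  then have "prod_avg w S n f x = (\<Sum>y\<in>{1..n} \<rightarrow>\<^sub>E S. (\<Prod>i\<in>{1..n}. w ((y \<circ> \<sigma>) i))
      * f (override_on x (y \<circ> \<sigma>) {1..n}))"
    unfolding prod_avg_eq_sum[OF S]
    by (rule sum.reindex_bij_betw[symmetric, where g = "\<lambda>y. (\<Prod>i\<in>{1..n}. w (y i)) * f (override_on x y {1..n})"])
  also have "\<dots> = prod_avg w S n (\<lambda>x. f (x \<circ> \<sigma>)) x"
    unfolding prod_avg_eq_sum[OF S]
  proof (intro sum.cong refl arg_cong2[where f = "(*)"])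
    fix y
    show "(\<Prod>i\<in>{1..n}. w ((y \<circ> \<sigma>) i)) = (\<Prod>i\<in>{1..n}. w (y i))"
      using prod.permute[OF \<sigma>, of "\<lambda>i. w (y i)"] by (simp add: o_def)
    show "f (override_on x (y \<circ> \<sigma>) {1..n}) = f (override_on x y {1..n} \<circ> \<sigma>)"
      using \<sigma>i by (intro f) (simp add: override_on_def)
  qed
  finally show ?thesis by simp
qed

lemma coord_avg_indep:
  "sum w S = 1 \<Longrightarrow> coord_indep i f \<Longrightarrow> coord_avg w S i f = f"
  by (simp add: coord_indep_def coord_avg_def flip: sum_distrib_right)

section \<open>Influences and variance\<close>

definition coord_dev :: "('a \<Rightarrow> real) \<Rightarrow> 'a set \<Rightarrow> nat \<Rightarrow> ((nat \<Rightarrow> 'a) \<Rightarrow> real) \<Rightarrow> (nat \<Rightarrow> 'a) \<Rightarrow> real"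
  where "coord_dev w S i f = (\<lambda>x. f x - coord_avg w S i f x)"

definition coord_ent :: "('a \<Rightarrow> real) \<Rightarrow> 'a set \<Rightarrow> nat \<Rightarrow> ((nat \<Rightarrow> 'a) \<Rightarrow> real) \<Rightarrow> (nat \<Rightarrow> 'a) \<Rightarrow> real"
  where "coord_ent w S i X = (\<lambda>x. coord_avg w S i (\<lambda>y. X y * ln (X y)) x
    - coord_avg w S i X x * ln (coord_avg w S i X x))"

text \<open>Differences of the Doob martingale in reverse order: \<open>prod_avg w S j f\<close> has
  coordinates \<open>1..j\<close> averaged out, so it starts at \<open>f\<close> and ends at the
  full average.\<close>

definition mart_diff :: "('a \<Rightarrow> real) \<Rightarrow> 'a set \<Rightarrow> nat \<Rightarrow> ((nat \<Rightarrow> 'a) \<Rightarrow> real) \<Rightarrow> (nat \<Rightarrow> 'a) \<Rightarrow> real"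
  where "mart_diff w S j f = (\<lambda>x. prod_avg w S j f x - prod_avg w S (Suc j) f x)"

lemma mart_diff_eq: "mart_diff w S j f = prod_avg w S j (coord_dev w S (Suc j) f)"
  by (simp add: mart_diff_def coord_dev_def prod_avg_diff prod_avg_coord_commute)

text \<open>Single-coordinate averages with equal weights commute, so taking deviations respects the
  martingale decomposition.\<close>

lemma coord_dev_mart_diff: "coord_dev w S i (mart_diff w S j f) = mart_diff w S j (coord_dev w S i f)"
  unfolding mart_diff_def coord_dev_def
  by (simp add: coord_avg_diff prod_avg_diff fun_eq_iff
      flip: prod_avg_coord_commute' prod_avg.simps(2))

text \<open>One coordinate is a finite probability space whose atoms weigh at least
  \<open>\<alpha>\<close>; this minimal weight governs the logarithmic Sobolev constant.\<close>

locale atomic_weights =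
  fixes w :: "'a \<Rightarrow> real" and S :: "'a set" and \<alpha> :: real
  assumes fin: "finite S" and w_ge: "a \<in> S \<Longrightarrow> \<alpha> \<le> w a" and sum_w: "sum w S = 1"
    and \<alpha>_pos: "0 < \<alpha>" and \<alpha>_le: "\<alpha> \<le> 1/4"
begin

abbreviation "E \<equiv> coord_avg w S"
abbreviation "P \<equiv> prod_avg w S"
abbreviation "D \<equiv> coord_dev w S"
abbreviation "M \<equiv> mart_diff w S"

lemma w_pos: "a \<in> S \<Longrightarrow> 0 < w a"
  using w_ge \<alpha>_pos by fastforce

lemma P_mono:
  "(\<And>y. (\<And>i. i \<in> {1..n} \<Longrightarrow> y i \<in> S) \<Longrightarrow> f y \<le> g y) \<Longrightarrow> P n f x \<le> P n g x"
  using fin w_pos by (intro prod_avg_mono) (auto simp: less_imp_le)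

lemma E_indep: "coord_indep i f \<Longrightarrow> E i f = f"
  using sum_w by (rule coord_avg_indep)

lemma P_indep: "(\<And>i. i \<in> {1..n} \<Longrightarrow> coord_indep i f) \<Longrightarrow> P n f = f"
  by (induction n) (simp_all add: E_indep)

lemma P_E: "i \<in> {1..n} \<Longrightarrow> P n (E i f) = P n f"
  by (simp only: prod_avg_coord_commute' E_indep coord_indep_prod_avg_le)

lemma P_E_last: "P (Suc n) (E (Suc n) f) = P (Suc n) f"
  by (rule P_E) simp

lemma P_P: "m \<le> n \<Longrightarrow> P n (P m f) = P n f"
  by (induction m) (simp_all add: P_E)

lemma P_const: "P n (\<lambda>_. c) = (\<lambda>_. c)"
  by (rule P_indep) (simp add: coord_indep_def)

section \<open>Orthogonality of martingale differences\<close>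

lemma E_dev_sq: "E i (\<lambda>x. (D i g x)\<^sup>2) = (\<lambda>x. E i (\<lambda>x. (g x)\<^sup>2) x - (E i g x)\<^sup>2)"
proof -
  have indep: "coord_indep i (\<lambda>x. 2 * E i g x)" "coord_indep i (\<lambda>x. (E i g x)\<^sup>2)"
    using coord_indep_avg[of i w S g] by (auto simp: coord_indep_def)
  have "(\<lambda>x. (D i g x)\<^sup>2) = (\<lambda>x. (g x)\<^sup>2 - 2 * E i g x * g x + (E i g x)\<^sup>2)"
    by (auto simp: coord_dev_def power2_eq_square algebra_simps)
  then have "E i (\<lambda>x. (D i g x)\<^sup>2) =
      (\<lambda>x. E i (\<lambda>x. (g x)\<^sup>2) x - 2 * E i g x * E i g x + (E i g x)\<^sup>2)"
    by (simp only: coord_avg_add coord_avg_diff coord_avg_mult_indep[OF indep(1)] E_indep[OF indep(2)])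
  then show ?thesis by (auto simp: power2_eq_square)
qed

lemma P_dev: "i \<in> {1..n} \<Longrightarrow> P n (D i f) = (\<lambda>_. 0)"
  by (simp add: coord_dev_def prod_avg_diff P_E)

lemma P_mart_diff_sq:
  assumes "j < n"
  shows "P n (\<lambda>x. (M j f x)\<^sup>2) x = P n (\<lambda>x. (P j f x)\<^sup>2) x - P n (\<lambda>x. (P (Suc j) f x)\<^sup>2) x"
proof -
  have M: "M j f = D (Suc j) (P j f)"
    by (simp add: mart_diff_def coord_dev_def)
  have "P n (\<lambda>x. (M j f x)\<^sup>2) = P n (E (Suc j) (\<lambda>x. (M j f x)\<^sup>2))"
    using assms by (intro P_E[symmetric]) auto
  also have "\<dots> = P n (\<lambda>x. E (Suc j) (\<lambda>x. (P j f x)\<^sup>2) x - (P (Suc j) f x)\<^sup>2)"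
    unfolding M E_dev_sq by simp
  also have "\<dots> = (\<lambda>x. P n (\<lambda>x. (P j f x)\<^sup>2) x - P n (\<lambda>x. (P (Suc j) f x)\<^sup>2) x)"
    unfolding prod_avg_diff using assms by (subst P_E) auto
  finally show ?thesis by simp
qed

text \<open>Each summand is a drop in second moment when one more coordinate is averaged out, so the
  sum telescopes to the variance.\<close>

lemma sum_P_mart_diff_sq:
  "(\<Sum>j<n. P n (\<lambda>x. (M j f x)\<^sup>2) x) = P n (\<lambda>x. (f x)\<^sup>2) x - (P n f x)\<^sup>2"
proof -
  have "(\<Sum>j<n. P n (\<lambda>x. (M j f x)\<^sup>2) x) =
      (\<Sum>j<n. P n (\<lambda>x. (P j f x)\<^sup>2) x - P n (\<lambda>x. (P (Suc j) f x)\<^sup>2) x)"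
    by (intro sum.cong refl P_mart_diff_sq) simp
  also have "\<dots> = P n (\<lambda>x. (P 0 f x)\<^sup>2) x - P n (\<lambda>x. (P n f x)\<^sup>2) x"
    by (rule sum_lessThan_telescope')
  also have "P n (\<lambda>x. (P n f x)\<^sup>2) = (\<lambda>x. (P n f x)\<^sup>2)"
    using coord_indep_prod_avg_le[of _ n w S f] by (intro P_indep) (simp add: coord_indep_def)
  finally show ?thesis by simp
qed

text \<open>For fixed \<open>i\<close>, the functions \<open>D (Suc i) (M j f)\<close> are the
  martingale differences of \<open>D (Suc i) f\<close>, which has mean zero; its variance is thus
  its second moment.\<close>

lemma sum_P_dev_mart_diff_sq:
  "(\<Sum>j<n. \<Sum>i<n. P n (\<lambda>x. (D (Suc i) (M j f) x)\<^sup>2) x) = (\<Sum>i<n. P n (\<lambda>x. (D (Suc i) f x)\<^sup>2) x)"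
proof (subst sum.swap, intro sum.cong refl)
  fix i assume "i \<in> {..<n}"
  then show "(\<Sum>j<n. P n (\<lambda>x. (D (Suc i) (M j f) x)\<^sup>2) x) = P n (\<lambda>x. (D (Suc i) f x)\<^sup>2) x"
    unfolding coord_dev_mart_diff sum_P_mart_diff_sq by (simp add: P_dev)
qed

lemma abs_P_le: "\<bar>P n f x\<bar> \<le> P n (\<lambda>x. \<bar>f x\<bar>) x"
proof -
  have "P n (\<lambda>x. - 1 * f x) x \<le> P n (\<lambda>x. \<bar>f x\<bar>) x" "P n f x \<le> P n (\<lambda>x. \<bar>f x\<bar>) x"
    by (auto intro!: P_mono)
  then show ?thesis unfolding prod_avg_cmult by linarith
qed

text \<open>A martingale difference is a partial average of a coordinate deviation, and averaging
  does not increase the mean absolute value.\<close>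

lemma P_abs_mart_diff_le:
  assumes "j < n"
  shows "P n (\<lambda>x. \<bar>M j f x\<bar>) x \<le> P n (\<lambda>x. \<bar>D (Suc j) f x\<bar>) x"
proof -
  have "P n (\<lambda>x. \<bar>M j f x\<bar>) x \<le> P n (P j (\<lambda>x. \<bar>D (Suc j) f x\<bar>)) x"
    unfolding mart_diff_eq by (intro P_mono abs_P_le)
  then show ?thesis using assms by (simp add: P_P)
qed

text \<open>All atoms have positive weight. This supplies the absolute continuity required by Gibbs'
  inequality.\<close>

lemma P_eq_0_imp:
  assumes X: "\<And>x. 0 \<le> X x" and 0: "P n X x = 0" and S: "\<And>i. i \<in> {1..n} \<Longrightarrow> x i \<in> S"
  shows "X x = 0"
  using 0 S
proof (induction n)
  case (Suc n)
  have "0 \<le> P n X y" for y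
    using P_mono[of n "\<lambda>_. 0" X y] X by (simp add: P_const)
  then have "\<forall>a\<in>S. w a * P n X (x(Suc n := a)) = 0"
    using Suc.prems(1) fin w_pos
    by (subst sum_nonneg_eq_0_iff[symmetric]) (auto simp: coord_avg_def less_imp_le)
  moreover have "x (Suc n) \<in> S" using Suc.prems(2) by simp
  ultimately have "P n X x = 0" using w_pos by fastforce
  then show ?case using Suc by simp
qed simp

section \<open>Subadditivity of entropy and the tensorised logarithmic Sobolev inequality\<close>

lemma E_gibbs:
  assumes "\<And>a. a \<in> S \<Longrightarrow> 0 \<le> X (x(i := a))" "\<And>a. a \<in> S \<Longrightarrow> 0 \<le> Y (x(i := a))"
    and "\<And>a. a \<in> S \<Longrightarrow> Y (x(i := a)) = 0 \<Longrightarrow> X (x(i := a)) = 0"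
  shows "E i (\<lambda>x. X x * (ln (Y x) - ln (E i Y x))) x \<le> coord_ent w S i X x"
  using sum_gibbs[OF fin w_pos, where X = "\<lambda>a. X (x(i := a))" and Y = "\<lambda>a. Y (x(i := a))"] assms
  by (simp add: coord_ent_def coord_avg_def)

text \<open>Writing \<open>Y = P n X\<close>, the left-hand side is the full average of
  \<open>X * (ln Y - ln (E Y))\<close>, so Gibbs' inequality applies fibrewise.\<close>

lemma P_coord_ent_avg_le:
  assumes X: "\<And>x. 0 \<le> X x"
  shows "P (Suc n) (coord_ent w S (Suc n) (P n X)) x \<le> P (Suc n) (coord_ent w S (Suc n) X) x"
proof -
  define i Y where "i = Suc n" and "Y = P n X"
  have Y0: "0 \<le> Y y" for y
    using P_mono[of n "\<lambda>_. 0" X y] X by (simp add: P_const Y_def)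
  have iY: "coord_indep j Y" if "j \<in> {1..n}" for j
    unfolding Y_def using that by (rule coord_indep_prod_avg_le)
  then have iEY: "coord_indep j (E i Y)" if "j \<in> {1..n}" for j
    using that by (intro coord_indep_avg_other) auto
  \<comment> \<open>\<open>Z\<close> does not depend on coordinates \<open>1..n\<close>, so it can
    be pulled through \<open>P n\<close>, which lets \<open>X\<close> replace \<open>Y\<close> as
    the factor beside it.\<close>
  define Z where "Z = (\<lambda>x. ln (Y x) - ln (E i Y x))"
  have iZ: "coord_indep j Z" if "j \<in> {1..n}" for j
    using iY[OF that] iEY[OF that] by (simp add: Z_def coord_indep_def)
  have "E i (\<lambda>x. ln (E i Y x) * Y x) = (\<lambda>x. ln (E i Y x) * E i Y x)"
    using coord_indep_avg[of i w S Y] by (intro coord_avg_mult_indep) (simp add: coord_indep_def)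
  then have "coord_ent w S i Y = E i (\<lambda>x. Z x * Y x)"
    by (simp add: coord_ent_def Z_def left_diff_distrib right_diff_distrib coord_avg_diff mult.commute)
  also have "(\<lambda>x. Z x * Y x) = P n (\<lambda>x. Z x * X x)"
    unfolding Y_def by (rule prod_avg_mult_indep[OF iZ, symmetric])
  finally have "P i (coord_ent w S i Y) = P i (\<lambda>x. Z x * X x)"
    by (simp only: i_def P_E_last P_P[OF le_SucI[OF order_refl]])
  also have "\<dots> = P i (E i (\<lambda>x. Z x * X x))"
    by (simp only: i_def P_E_last)
  finally have eq: "P i (coord_ent w S i Y) = P i (E i (\<lambda>x. X x * (ln (Y x) - ln (E i Y x))))"
    by (simp add: Z_def mult.commute)
  have "P i (E i (\<lambda>x. X x * (ln (Y x) - ln (E i Y x)))) x \<le> P i (coord_ent w S i X) x"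
  proof (intro P_mono E_gibbs X Y0)
    fix y a assume "\<And>j. j \<in> {1..i} \<Longrightarrow> y j \<in> S" "a \<in> S" "Y (y(i := a)) = 0"
    then show "X (y(i := a)) = 0"
      using X by (intro P_eq_0_imp[of X n]) (auto simp: Y_def i_def)
  qed
  then show ?thesis unfolding eq[symmetric] by (simp only: i_def Y_def)
qed

text \<open>Induction by the chain rule: the entropy over one more coordinate is the averaged
  entropy over the first \<open>n\<close> plus that of the marginal \<open>P n X\<close> in the new
  coordinate. The latter is at most the averaged coordinate entropy of \<open>X\<close>.\<close>

lemma entropy_subadditive:
  assumes X: "\<And>x. 0 \<le> X x"
  shows "P n (\<lambda>x. X x * ln (X x)) x - P n X x * ln (P n X x)
    \<le> (\<Sum>i<n. P n (coord_ent w S (Suc i) X) x)"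
proof (induction n arbitrary: x)
  case (Suc n)
  let ?G = "\<lambda>x. P n (\<lambda>x. X x * ln (X x)) x - P n X x * ln (P n X x)"
  have "P (Suc n) ?G x \<le> P (Suc n) (\<lambda>x. \<Sum>i<n. P n (coord_ent w S (Suc i) X) x) x"
    by (intro P_mono Suc)
  also have "\<dots> = (\<Sum>i<n. P (Suc n) (coord_ent w S (Suc i) X) x)"
    unfolding prod_avg_sum by (simp only: P_P[OF le_SucI[OF order_refl]])
  finally have 1: "P (Suc n) ?G x \<le> (\<Sum>i<n. P (Suc n) (coord_ent w S (Suc i) X) x)" .
  have indep: "coord_indep i (\<lambda>x. P (Suc n) X x * ln (P (Suc n) X x))" if "i \<in> {1..Suc n}" for i
    using coord_indep_prod_avg_le[OF that, of w S X] by (simp only: coord_indep_def simp_thms)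
  \<comment> \<open>The chain rule: the terms in \<open>P n X * ln (P n X)\<close> cancel.\<close>
  have "P (Suc n) ?G x + P (Suc n) (coord_ent w S (Suc n) (P n X)) x
      = P (Suc n) (\<lambda>x. X x * ln (X x)) x - P (Suc n) X x * ln (P (Suc n) X x)"
  proof -
    have "coord_ent w S (Suc n) (P n X) = (\<lambda>x. E (Suc n) (\<lambda>y. P n X y * ln (P n X y)) x
        - P (Suc n) X x * ln (P (Suc n) X x))"
      by (simp add: coord_ent_def)
    then have "P (Suc n) (coord_ent w S (Suc n) (P n X)) = (\<lambda>x. P (Suc n) (\<lambda>y. P n X y * ln (P n X y)) x
        - P (Suc n) X x * ln (P (Suc n) X x))"
      by (simp only: prod_avg_diff P_indep[OF indep] P_E_last)
    moreover have "P (Suc n) ?G = (\<lambda>x. P (Suc n) (\<lambda>x. X x * ln (X x)) x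
        - P (Suc n) (\<lambda>y. P n X y * ln (P n X y)) x)"
      by (simp only: prod_avg_diff P_P[OF le_SucI[OF order_refl]])
    ultimately show ?thesis by simp
  qed
  then show ?case
    using 1 P_coord_ent_avg_le[where X = X and n = n and x = x, OF X] by simp
qed simp

lemma coord_ent_sq_le: "coord_ent w S i (\<lambda>x. (g x)\<^sup>2) x \<le> 2 / \<alpha> * E i (\<lambda>x. (D i g x)\<^sup>2) x"
  using sum_log_sobolev[OF fin w_ge sum_w \<alpha>_pos \<alpha>_le, where g = "\<lambda>a. g (x(i := a))"]
  by (simp add: coord_ent_def coord_avg_def coord_dev_def)

lemma log_sobolev:
  "P n (\<lambda>x. (g x)\<^sup>2 * ln ((g x)\<^sup>2)) x - P n (\<lambda>x. (g x)\<^sup>2) x * ln (P n (\<lambda>x. (g x)\<^sup>2) x)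
    \<le> 2 / \<alpha> * (\<Sum>i<n. P n (\<lambda>x. (D (Suc i) g x)\<^sup>2) x)"
proof -
  have "(\<Sum>i<n. P n (coord_ent w S (Suc i) (\<lambda>x. (g x)\<^sup>2)) x)
      \<le> (\<Sum>i<n. P n (\<lambda>x. 2 / \<alpha> * E (Suc i) (\<lambda>x. (D (Suc i) g x)\<^sup>2) x) x)"
    by (intro sum_mono P_mono coord_ent_sq_le)
  also have "\<dots> = 2 / \<alpha> * (\<Sum>i<n. P n (\<lambda>x. (D (Suc i) g x)\<^sup>2) x)"
    unfolding prod_avg_cmult by (simp add: P_E sum_distrib_left)
  finally show ?thesis
    using entropy_subadditive[of "\<lambda>x. (g x)\<^sup>2" n x] by simp
qed

text \<open>Bounds the entropy of \<open>g\<^sup>2\<close> from below when \<open>g\<close> has small \<open>L\<^sup>1\<close> norm.\<close>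

lemma P_sq_mul_ln_ge:
  assumes b: "0 < b" "P n (\<lambda>x. \<bar>g x\<bar>) x \<le> b"
  defines "e \<equiv> P n (\<lambda>x. (g x)\<^sup>2) x"
  shows "2 * e * ln e - 2 * e * ln b \<le> P n (\<lambda>x. (g x)\<^sup>2 * ln ((g x)\<^sup>2)) x"
proof -
  \<comment> \<open>The bound comes from \<open>ln x \<le> x - 1\<close> at
    \<open>\<delta> / \<bar>g y\<bar>\<close>. The free parameter is optimal at
    \<open>\<delta> = e / b\<close>, used below for \<open>e > 0\<close>; for \<open>e = 0\<close>
    it tends to zero.\<close>
  have *: "2 * ln \<delta> * e + 2 * e - 2 * \<delta> * b \<le> P n (\<lambda>x. (g x)\<^sup>2 * ln ((g x)\<^sup>2)) x"
    if \<delta>: "0 < \<delta>" for \<delta>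
  proof -
    have "2 * ln \<delta> * (g y)\<^sup>2 + 2 * (g y)\<^sup>2 - 2 * \<delta> * \<bar>g y\<bar> \<le> (g y)\<^sup>2 * ln ((g y)\<^sup>2)" for y
    proof (cases "g y = 0")
      case False
      have sq: "(g y)\<^sup>2 = \<bar>g y\<bar> * \<bar>g y\<bar>" by (simp add: power2_eq_square)
      have "ln (\<delta> / \<bar>g y\<bar>) \<le> \<delta> / \<bar>g y\<bar> - 1"
        using \<delta> False by (intro ln_le_minus_one) simp
      then have "(g y)\<^sup>2 * (ln \<delta> - ln \<bar>g y\<bar>) \<le> (g y)\<^sup>2 * (\<delta> / \<bar>g y\<bar> - 1)"
        using \<delta> False by (intro mult_left_mono) (simp_all add: ln_div)
      also have "\<dots> = \<delta> * \<bar>g y\<bar> - (g y)\<^sup>2"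
        using False unfolding sq by (simp add: right_diff_distrib del: abs_mult_self_eq)
      finally have "(g y)\<^sup>2 * (ln \<delta> - ln \<bar>g y\<bar>) \<le> \<delta> * \<bar>g y\<bar> - (g y)\<^sup>2" .
      moreover have "ln ((g y)\<^sup>2) = 2 * ln \<bar>g y\<bar>"
        using False unfolding sq by (simp add: ln_mult del: abs_mult_self_eq)
      ultimately show ?thesis by (simp add: algebra_simps)
    qed simp
    then have "P n (\<lambda>y. 2 * ln \<delta> * (g y)\<^sup>2 + 2 * (g y)\<^sup>2 - 2 * \<delta> * \<bar>g y\<bar>) x
        \<le> P n (\<lambda>x. (g x)\<^sup>2 * ln ((g x)\<^sup>2)) x"
      by (intro P_mono)
    then have "2 * ln \<delta> * e + 2 * e - 2 * \<delta> * P n (\<lambda>x. \<bar>g x\<bar>) x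
        \<le> P n (\<lambda>x. (g x)\<^sup>2 * ln ((g x)\<^sup>2)) x"
      unfolding prod_avg_diff prod_avg_add prod_avg_cmult e_def .
    moreover have "2 * \<delta> * P n (\<lambda>x. \<bar>g x\<bar>) x \<le> 2 * \<delta> * b"
      using b \<delta> by (intro mult_left_mono) auto
    ultimately show ?thesis by linarith
  qed
  have "0 \<le> e" unfolding e_def using P_mono[of n "\<lambda>_. 0" "\<lambda>x. (g x)\<^sup>2" x] by (simp add: P_const)
  then consider "0 < e" | "e = 0" by linarith
  then show ?thesis
  proof cases
    case 1
    then have "2 * ln (e / b) * e + 2 * e - 2 * (e / b) * b = 2 * e * ln e - 2 * e * ln b"
      using b by (simp add: ln_div algebra_simps)
    then show ?thesis using *[of "e / b"] 1 b by simp
  next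
    case 2
    have "0 \<le> P n (\<lambda>x. (g x)\<^sup>2 * ln ((g x)\<^sup>2)) x + \<epsilon>" if "0 < \<epsilon>" for \<epsilon>
      using *[of "\<epsilon> / (2 * b)"] b that 2 by simp
    then have "0 \<le> P n (\<lambda>x. (g x)\<^sup>2 * ln ((g x)\<^sup>2)) x" by (rule field_le_epsilon)
    then show ?thesis using 2 by simp
  qed
qed

text \<open>The logarithmic Sobolev inequality is applied to each martingale difference of \<open>f\<close>
  separately, not to \<open>f\<close> itself.\<close>

lemma falik_samorodnitsky:
  assumes b: "0 < b" "\<And>j. j < n \<Longrightarrow> P n (\<lambda>x. \<bar>D (Suc j) f x\<bar>) x \<le> b"
  defines "V \<equiv> P n (\<lambda>x. (f x)\<^sup>2) x - (P n f x)\<^sup>2"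
  assumes V: "0 < V"
  shows "V * ln (V / (real n * b\<^sup>2)) \<le> 2 / \<alpha> * (\<Sum>i<n. P n (\<lambda>x. (D (Suc i) f x)\<^sup>2) x)"
proof -
  define e where "e j = P n (\<lambda>x. (M j f x)\<^sup>2) x" for j
  have e0: "0 \<le> e j" for j
    unfolding e_def using P_mono[of n "\<lambda>_. 0" "\<lambda>x. (M j f x)\<^sup>2" x] by (simp add: P_const)
  have sum_e: "(\<Sum>j<n. e j) = V"
    unfolding e_def V_def by (rule sum_P_mart_diff_sq)
  then have n: "0 < real n" using V by (cases n) auto
  \<comment> \<open>The logarithmic Sobolev inequality bounds the entropy of the squared difference
    above, and its small mean absolute value bounds it below.\<close>
  have entropy: "e j * ln (e j) - 2 * e j * ln b \<le> 2 / \<alpha> * (\<Sum>i<n. P n (\<lambda>x. (D (Suc i) (M j f) x)\<^sup>2) x)"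
    if "j < n" for j
  proof -
    have "P n (\<lambda>x. \<bar>M j f x\<bar>) x \<le> b"
      using P_abs_mart_diff_le[OF that, of f x] b(2)[OF that] by linarith
    from P_sq_mul_ln_ge[OF b(1) this] log_sobolev[of n "M j f" x]
    show ?thesis unfolding e_def by linarith
  qed
  \<comment> \<open>Tangent-line form of the log-sum inequality at the mean \<open>V / n\<close> of
    the \<open>e j\<close>; the linear terms cancel in the sum.\<close>
  have log_sum: "e j * ln (V / n) + e j - V / n \<le> e j * ln (e j)" for j
  proof (cases "e j = 0")
    case False
    then have p: "0 < e j" using e0[of j] by simp
    have "ln (V / n / e j) \<le> V / n / e j - 1"
      using p V n by (intro ln_le_minus_one) simp
    then have "e j * (ln (V / n) - ln (e j)) \<le> e j * (V / n / e j - 1)"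
      using p V n by (intro mult_left_mono) (simp_all add: ln_div ln_mult)
    then show ?thesis using p by (simp add: algebra_simps)
  qed (use V n in simp)
  have "V * ln (V / (n * b\<^sup>2)) = V * ln (V / n) - 2 * V * ln b"
    using V n b by (simp add: ln_div ln_mult ln_realpow algebra_simps)
  also have "\<dots> = (\<Sum>j<n. e j * ln (V / n) + e j - V / n) - 2 * V * ln b"
    using n by (simp add: sum.distrib sum_subtractf sum_e flip: sum_distrib_right)
  also have "\<dots> \<le> (\<Sum>j<n. e j * ln (e j)) - 2 * V * ln b"
    using log_sum by (intro diff_right_mono sum_mono)
  also have "\<dots> = (\<Sum>j<n. e j * ln (e j) - 2 * e j * ln b)"
    unfolding sum_e[symmetric] by (simp add: sum_subtractf sum_distrib_right sum_distrib_left)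
  also have "\<dots> \<le> (\<Sum>j<n. 2 / \<alpha> * (\<Sum>i<n. P n (\<lambda>x. (D (Suc i) (M j f) x)\<^sup>2) x))"
    by (intro sum_mono entropy) simp
  also have "\<dots> = 2 / \<alpha> * (\<Sum>i<n. P n (\<lambda>x. (D (Suc i) f x)\<^sup>2) x)"
    unfolding sum_distrib_left[symmetric] sum_P_dev_mart_diff_sq ..
  finally show ?thesis .
qed

text \<open>\<open>M j f\<close> is centred in coordinate \<open>Suc j\<close>, hence equals its own
  deviation there; keeping only these diagonal terms of the double sum gives the bound.\<close>

lemma efron_stein:
  "P n (\<lambda>x. (f x)\<^sup>2) x - (P n f x)\<^sup>2 \<le> (\<Sum>i<n. P n (\<lambda>x. (D (Suc i) f x)\<^sup>2) x)"
proof -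
  have "P n (\<lambda>x. (M j f x)\<^sup>2) x \<le> (\<Sum>i<n. P n (\<lambda>x. (D (Suc i) (M j f) x)\<^sup>2) x)" if "j < n" for j
  proof -
    have "D (Suc j) (M j f) = M j f"
      unfolding mart_diff_def coord_dev_def
      by (simp add: coord_avg_diff E_indep[OF coord_indep_avg])
    then have "P n (\<lambda>x. (M j f x)\<^sup>2) x = P n (\<lambda>x. (D (Suc j) (M j f) x)\<^sup>2) x" by simp
    also have "\<dots> \<le> (\<Sum>i<n. P n (\<lambda>x. (D (Suc i) (M j f) x)\<^sup>2) x)"
    proof (rule member_le_sum)
      fix i show "0 \<le> P n (\<lambda>x. (D (Suc i) (M j f) x)\<^sup>2) x"
        using P_mono[of n "\<lambda>_. 0" "\<lambda>x. (D (Suc i) (M j f) x)\<^sup>2" x] by (simp add: P_const)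
    qed (use that in auto)
    finally show ?thesis .
  qed
  then have "(\<Sum>j<n. P n (\<lambda>x. (M j f x)\<^sup>2) x) \<le> (\<Sum>j<n. \<Sum>i<n. P n (\<lambda>x. (D (Suc i) (M j f) x)\<^sup>2) x)"
    by (intro sum_mono) simp
  then show ?thesis unfolding sum_P_mart_diff_sq sum_P_dev_mart_diff_sq .
qed

section \<open>Influences of Boolean functions\<close>

lemma E_dev_sq_bool:
  assumes "\<And>x. f x \<in> {0, 1}"
  shows "E i (\<lambda>x. (D i f x)\<^sup>2) = (\<lambda>x. E i f x - (E i f x)\<^sup>2)"
proof -
  have "(\<lambda>x. (f x)\<^sup>2) = f" using assms by (auto simp: fun_eq_iff power2_eq_square)
  then show ?thesis by (simp add: E_dev_sq)
qed

text \<open>A Boolean variable of mean \<open>p\<close> has mean absolute deviation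
  \<open>2 * p * (1 - p)\<close>, twice its variance. Small influences therefore yield the small
  \<open>b\<close> of \<open>falik_samorodnitsky\<close>.\<close>

lemma P_abs_dev_bool:
  assumes f: "\<And>x. f x \<in> {0, 1}" and i: "i \<in> {1..n}"
  shows "P n (\<lambda>x. \<bar>D i f x\<bar>) x = 2 * P n (\<lambda>x. (D i f x)\<^sup>2) x"
proof -
  have f01: "0 \<le> f x" "f x \<le> 1" for x using f[of x] by auto
  have E01: "0 \<le> E i f x" "E i f x \<le> 1" for x
  proof -
    show "0 \<le> E i f x"
      unfolding coord_avg_def using f01 w_pos by (intro sum_nonneg) (simp add: less_imp_le)
    have "E i f x \<le> sum w S"
      unfolding coord_avg_def using f01 w_pos by (intro sum_mono mult_left_le) (auto simp: less_imp_le)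
    then show "E i f x \<le> 1" by (simp add: sum_w)
  qed
  have indep: "coord_indep i (\<lambda>x. 2 * E i f x)"
    using coord_indep_avg[of i w S f] by (simp add: coord_indep_def)
  have "\<bar>D i f x\<bar> = f x + E i f x - 2 * E i f x * f x" for x
    using f[of x] E01[of x] by (auto simp: coord_dev_def)
  then have "E i (\<lambda>x. \<bar>D i f x\<bar>) = E i (\<lambda>x. f x + E i f x - 2 * E i f x * f x)" by simp
  also have "\<dots> = (\<lambda>x. E i f x + E i f x - 2 * E i f x * E i f x)"
    unfolding coord_avg_diff coord_avg_add coord_avg_mult_indep[OF indep]
      E_indep[OF coord_indep_avg] ..
  also have "\<dots> = (\<lambda>x. 2 * E i (\<lambda>x. (D i f x)\<^sup>2) x)"
    unfolding E_dev_sq_bool[OF f] by (auto simp: power2_eq_square)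
  finally have "P n (E i (\<lambda>x. \<bar>D i f x\<bar>)) = P n (\<lambda>x. 2 * E i (\<lambda>x. (D i f x)\<^sup>2) x)" by simp
  then show ?thesis unfolding prod_avg_cmult P_E[OF i] by simp
qed

text \<open>If \<open>J\<close> were too small, \<open>V / (n * b^2)\<close> with
  \<open>b = 2 * J / n\<close> would be at least the square root of \<open>n\<close>, and
  \<open>falik_samorodnitsky\<close> would force \<open>J\<close> up to the claimed bound.\<close>

lemma influence_bool:
  assumes f: "\<And>x. f x \<in> {0, 1}" and n: "1 \<le> n"
    and I: "\<And>i. i < n \<Longrightarrow> P n (\<lambda>x. (D (Suc i) f x)\<^sup>2) x = J / real n"
  defines "V \<equiv> P n f x * (1 - P n f x)"
  shows "\<alpha> / 4 * V * ln (real n) \<le> J"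
proof (rule ccontr)
  assume neg: "\<not> \<alpha> / 4 * V * ln (real n) \<le> J"
  have sum_I: "(\<Sum>i<n. P n (\<lambda>x. (D (Suc i) f x)\<^sup>2) x) = J"
    using n by (simp add: I)
  have V_eq: "V = P n (\<lambda>x. (f x)\<^sup>2) x - (P n f x)\<^sup>2"
  proof -
    have "(\<lambda>x. (f x)\<^sup>2) = f" using f by (auto simp: fun_eq_iff power2_eq_square)
    then show ?thesis by (simp add: V_def power2_eq_square algebra_simps)
  qed
  \<comment> \<open>This makes \<open>J\<close>, and hence \<open>b\<close> below, positive once
    \<open>V\<close> is.\<close>
  have VJ: "V \<le> J" using efron_stein[of n f x] unfolding sum_I V_eq .
  have lnn: "0 \<le> ln (real n)" using n by simp
  have J0: "0 \<le> J"
    unfolding sum_I[symmetric] using P_mono[of n "\<lambda>_. 0" "\<lambda>x. (D _ f x)\<^sup>2" x]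
    by (intro sum_nonneg) (simp add: P_const)
  have V: "0 < V"
  proof (rule ccontr)
    assume "\<not> 0 < V"
    then have "\<alpha> / 4 * V * ln (real n) \<le> 0"
      using \<alpha>_pos lnn by (intro mult_nonpos_nonneg mult_nonneg_nonpos) auto
    then show False using neg J0 by simp
  qed
  have V4: "V \<le> 1/4"
  proof -
    have "0 \<le> (P n f x - 1/2)\<^sup>2" by simp
    then show ?thesis by (simp add: V_def power2_eq_square algebra_simps)
  qed
  have J: "0 < J" using V VJ by simp
  define b where "b = 2 * J / real n"
  have "V * ln (V / (real n * b\<^sup>2)) \<le> 2 / \<alpha> * J"
    unfolding sum_I[symmetric] V_eq
  proof (rule falik_samorodnitsky)
    show "0 < b" using J n by (simp add: b_def)
    show "P n (\<lambda>x. \<bar>D (Suc j) f x\<bar>) x \<le> b" if "j < n" for j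
      using that I by (subst P_abs_dev_bool[OF f]) (auto simp: b_def)
    show "0 < P n (\<lambda>x. (f x)\<^sup>2) x - (P n f x)\<^sup>2" using V by (simp only: V_eq)
  qed
  moreover have "V * (ln (real n) / 2) \<le> V * ln (V / (real n * b\<^sup>2))"
  proof -
    \<comment> \<open>The fourth root gives \<open>ln n = 4 * ln r\<close> with
      \<open>ln r \<le> r\<close>, so the assumed bound on \<open>J\<close> yields
      \<open>4 * J^2 \<le> V * r^2\<close>, where \<open>r^2\<close> is the square root of
      \<open>n\<close>.\<close>
    define r where "r = real n powr (1/4)"
    have n0: "0 < real n" using n by simp
    have r: "0 < r" "ln (real n) = 4 * ln r"
      using n0 by (auto simp: r_def ln_powr)
    then have "real n = exp (4 * ln r)" using n0 by (simp flip: r(2))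
    also have "\<dots> = r ^ 4" using r(1) exp_of_nat_mult[of 4 "ln r"] by simp
    finally have nr: "real n = r ^ 4" .
    have "J < \<alpha> / 4 * V * ln (real n)" using neg by simp
    also have "\<dots> = \<alpha> * (V * ln r)" using r by simp
    also have "\<dots> \<le> 1/4 * (V * ln r)"
      using \<alpha>_le V r lnn by (intro mult_right_mono) auto
    also have "\<dots> \<le> 1/4 * (V * r)"
      using V ln_le_minus_one[OF r(1)] by simp
    finally have "J \<le> V * r / 4" by simp
    then have "J\<^sup>2 \<le> (V * r / 4)\<^sup>2" using J by (intro power_mono) auto
    also have "\<dots> = V * (V * r\<^sup>2 / 16)" by (simp add: power2_eq_square)
    also have "\<dots> \<le> V * (r\<^sup>2 / 4)" using V V4 r by (intro mult_left_mono) (auto simp: field_simps)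
    finally have J2: "4 * J\<^sup>2 \<le> V * r\<^sup>2" by simp
    have "r\<^sup>2 * (4 * J\<^sup>2) \<le> r\<^sup>2 * (V * r\<^sup>2)" using J2 by (intro mult_left_mono) auto
    also have "\<dots> = V * real n" by (simp add: nr power2_eq_square power4_eq_xxxx)
    finally have "r\<^sup>2 \<le> V * real n / (4 * J\<^sup>2)" using J by (simp add: field_simps)
    also have "\<dots> = V / (real n * b\<^sup>2)" using n0 J by (simp add: b_def field_simps power2_eq_square)
    finally have "ln (r\<^sup>2) \<le> ln (V / (real n * b\<^sup>2))"
      using r by (intro ln_mono) auto
    then show ?thesis using r V by (simp add: ln_realpow)
  qed
  ultimately have "V * (ln (real n) / 2) \<le> 2 / \<alpha> * J" by linarith
  then have "\<alpha> / 4 * V * ln (real n) \<le> J" using \<alpha>_pos by (simp add: field_simps)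
  then show False using neg by simp
qed

end

text \<open>A Russo-type formula: by the product rule, each coordinate in turn has its weights
  replaced by their derivative.\<close>

lemma DERIV_prod_avg:
  assumes "finite S" "sum (w t) S = 1"
    and w: "\<And>a. a \<in> S \<Longrightarrow> ((\<lambda>t. w t a) has_real_derivative w' a) (at t)"
  shows "((\<lambda>t. prod_avg (w t) S n f x) has_real_derivative
    (\<Sum>i<n. prod_avg (w t) S n (coord_avg w' S (Suc i) f) x)) (at t)"
proof (induction n arbitrary: x)
  case (Suc n)
  have "((\<lambda>t. \<Sum>a\<in>S. w t a * prod_avg (w t) S n f (x(Suc n := a))) has_real_derivative
      (\<Sum>a\<in>S. w' a * prod_avg (w t) S n f (x(Suc n := a)) +
        (\<Sum>i<n. prod_avg (w t) S n (coord_avg w' S (Suc i) f) (x(Suc n := a))) * w t a)) (at t)"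
    by (intro DERIV_sum DERIV_mult w Suc)
  moreover have "(\<lambda>t. \<Sum>a\<in>S. w t a * prod_avg (w t) S n f (x(Suc n := a)))
      = (\<lambda>t. prod_avg (w t) S (Suc n) f x)"
    by (simp add: coord_avg_def)
  moreover have "(\<Sum>a\<in>S. w' a * prod_avg (w t) S n f (x(Suc n := a)) +
        (\<Sum>i<n. prod_avg (w t) S n (coord_avg w' S (Suc i) f) (x(Suc n := a))) * w t a)
      = (\<Sum>i<Suc n. prod_avg (w t) S (Suc n) (coord_avg w' S (Suc i) f) x)"
  proof -
    \<comment> \<open>Coordinate \<open>Suc n\<close> is already summed out by \<open>w'\<close>;
      averaging over it again changes nothing because the total weight is one.\<close>
    have last: "prod_avg (w t) S (Suc n) (coord_avg w' S (Suc n) f) x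
        = (\<Sum>a\<in>S. w' a * prod_avg (w t) S n f (x(Suc n := a)))"
      using assms(2)
      by (simp add: prod_avg_coord_commute coord_avg_indep[OF _ coord_indep_avg])
        (simp add: coord_avg_def)
    have "(\<Sum>i<n. prod_avg (w t) S (Suc n) (g i) x)
        = (\<Sum>a\<in>S. (\<Sum>i<n. prod_avg (w t) S n (g i) (x(Suc n := a))) * w t a)"
      for g :: "nat \<Rightarrow> (nat \<Rightarrow> 'a) \<Rightarrow> real"
      by (simp add: coord_avg_def sum_distrib_left mult.commute) (rule sum.swap)
    then show ?thesis by (simp only: sum.lessThan_Suc last sum.distrib add.commute)
  qed
  ultimately show ?case by simp
qed simp

text \<open>The differential inequality makes \<open>F t * exp (- c * t)\<close>
  nondecreasing.\<close>

lemma gronwall_backward: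
  fixes F F' :: "real \<Rightarrow> real"
  assumes "a \<le> b" and F: "\<And>t. t \<in> {a..b} \<Longrightarrow> (F has_real_derivative F' t) (at t)"
    and ge: "\<And>t. t \<in> {a..b} \<Longrightarrow> c * F t \<le> F' t"
  shows "F a \<le> F b * exp (- c * (b - a))"
proof -
  have "F a * exp (- c * a) \<le> F b * exp (- c * b)"
  proof (rule DERIV_nonneg_imp_nondecreasing[OF \<open>a \<le> b\<close>])
    fix t assume "a \<le> t" "t \<le> b"
    then have t: "t \<in> {a..b}" by simp
    have "((\<lambda>t. F t * exp (- c * t)) has_real_derivative (F' t - c * F t) * exp (- c * t)) (at t)"
      by (auto intro!: derivative_eq_intros F[OF t] simp: algebra_simps)
    then show "\<exists>y. ((\<lambda>t. F t * exp (- c * t)) has_real_derivative y) (at t) \<and> 0 \<le> y"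
      using ge[OF t] by (intro exI conjI) auto
  qed
  then have "F a * exp (- c * a) * exp (c * a) \<le> F b * exp (- c * b) * exp (c * a)"
    by (intro mult_right_mono) auto
  then show ?thesis by (simp add: mult.assoc algebra_simps flip: exp_add)
qed

section \<open>Intersecting families of vectors\<close>

text \<open>\<open>(False, a)\<close> encodes the singleton \<open>{a}\<close> and \<open>(True, a)\<close> its complement in \<open>[k]\<close>.\<close>

definition cell :: "nat \<Rightarrow> bool \<times> nat \<Rightarrow> nat set" where
  "cell k p = (if fst p then {1..k} - {snd p} else {snd p})"

definition cell_weight :: "nat \<Rightarrow> real \<Rightarrow> bool \<times> nat \<Rightarrow> real" where
  "cell_weight k t p = (if fst p then t else 1 - t) / real k"

definition upset :: "nat \<Rightarrow> nat \<Rightarrow> (nat \<Rightarrow> nat) set \<Rightarrow> (nat \<Rightarrow> bool \<times> nat) \<Rightarrow> real" where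
  "upset k n A x = of_bool (\<exists>y\<in>A. \<forall>i\<in>{1..n}. y i \<in> cell k (x i))"

definition cells :: "nat \<Rightarrow> (bool \<times> nat) set" where
  "cells k = UNIV \<times> {1..k}"

lemma finite_cells: "finite (cells k)"
  by (simp add: cells_def)

lemma upset_01: "upset k n A x \<in> {0, 1}"
  by (simp add: upset_def of_bool_def)

lemma upset_cong: "(\<And>i. i \<in> {1..n} \<Longrightarrow> x i = y i) \<Longrightarrow> upset k n A x = upset k n A y"
  by (simp add: upset_def)

lemma sum_cells: "(\<Sum>p\<in>cells k. g p) = (\<Sum>a\<in>{1..k}. g (False, a)) + (\<Sum>a\<in>{1..k}. g (True, a))"
  by (simp add: cells_def sum.cartesian_product' UNIV_bool)

lemma sum_cell_weight: "0 < k \<Longrightarrow> sum (cell_weight k t) (cells k) = 1"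
  by (simp add: sum_cells cell_weight_def field_simps)

text \<open>The lightest atoms are the complements, of weight \<open>t / k\<close>. Keeping
  \<open>t\<close> at least \<open>1/4\<close> makes the logarithmic Sobolev constant of order
  \<open>k\<close>.\<close>

lemma atomic_cell_weight:
  assumes "3 \<le> k" "t \<in> {1/4..1/2}"
  shows "atomic_weights (cell_weight k t) (cells k) (1 / (4 * real k))"
proof
  show "sum (cell_weight k t) (cells k) = 1" using assms(1) by (simp add: sum_cell_weight)
qed (use assms in \<open>auto simp: finite_cells cell_weight_def field_simps\<close>)

text \<open>The hypothesis \<open>k \<ge> 3\<close> enters in the case of a fibre with exactly one singleton, where
  the available lower bound \<open>(k - 2)/k\<close> for the derivative vanishes if \<open>k = 2\<close>.\<close>

lemma upset_fibre:
  fixes i n :: nat and A :: "(nat \<Rightarrow> nat) set" and x :: "nat \<Rightarrow> bool \<times> nat"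
  assumes k: "3 \<le> k"
  defines "f \<equiv> upset k n A"
  defines "\<Delta> \<equiv> coord_avg (\<lambda>p. (if fst p then 1 else - 1) / real k) (cells k) i f x"
  shows "0 \<le> \<Delta>"
    and "t \<in> {1/4..1/2} \<Longrightarrow>
      coord_avg (cell_weight k t) (cells k) i f x - (coord_avg (cell_weight k t) (cells k) i f x)\<^sup>2 \<le> \<Delta>"
proof -
  define G where "G = {a\<in>{1..k}. f (x(i := (False, a))) = 1}"
  define H where "H = {a\<in>{1..k}. f (x(i := (True, a))) = 1}"
  have f01: "f y = of_bool (f y = 1)" for y
    using upset_01[of k n A y] by (auto simp: f_def)
  have card_sum: "(\<Sum>a\<in>{1..k}. f (x(i := (b, a)))) = real (card {a\<in>{1..k}. f (x(i := (b, a))) = 1})" for b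
    by (subst f01) (simp add: Int_def flip: sum.inter_filter)
  \<comment> \<open>The proportions of singletons and of complements in this fibre for which the box
    meets \<open>A\<close>. The fibre average is \<open>(1 - t) * g + t * h\<close>, with derivative
    \<open>h - g\<close>.\<close>
  define g h where "g = real (card G) / k" and "h = real (card H) / k"
  have \<Delta>: "\<Delta> = h - g"
    using card_sum
    by (simp add: \<Delta>_def coord_avg_def sum_cells g_def h_def G_def H_def sum_negf diff_divide_distrib
        flip: sum_divide_distrib)
  have E: "coord_avg (cell_weight k t) (cells k) i f x = (1 - t) * g + t * h"
    using card_sum
    by (simp add: coord_avg_def sum_cells cell_weight_def g_def h_def G_def H_def
        add_divide_distrib flip: sum_divide_distrib sum_distrib_left)
  have fin: "finite G" "finite H" by (auto simp: G_def H_def)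
  have "G \<subseteq> {1..k}" "H \<subseteq> {1..k}" by (auto simp: G_def H_def)
  from this[THEN card_mono[OF finite_atLeastAtMost]]
  have le: "card G \<le> k" "card H \<le> k" by simp_all
  \<comment> \<open>Monotonicity: \<open>{a}\<close> is contained in the complement of
    \<open>{b}\<close> whenever \<open>b\<close> differs from \<open>a\<close>.\<close>
  have GH: "b \<in> H" if "a \<in> G" "b \<in> {1..k}" "b \<noteq> a" for a b
  proof -
    have "a \<in> {1..k}" using that(1) by (simp add: G_def)
    then have sub: "cell k ((x(i := (False, a))) j) \<subseteq> cell k ((x(i := (True, b))) j)" for j
      using that(3) by (auto simp: cell_def)
    have "f (x(i := (False, a))) = 1" using that(1) by (simp add: G_def)
    then obtain y where "y \<in> A" "\<forall>j\<in>{1..n}. y j \<in> cell k ((x(i := (False, a))) j)"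
      by (auto simp: f_def upset_def split: if_splits simp del: fun_upd_apply)
    then have "f (x(i := (True, b))) = 1"
      using sub by (auto simp: f_def upset_def simp del: fun_upd_apply)
    then show ?thesis using that(2) by (simp add: H_def)
  qed
  have k0: "0 < real k" using k by simp
  \<comment> \<open>One element of \<open>G\<close> puts all other labels into \<open>H\<close>; two
    distinct elements together put every label there.\<close>
  consider (none) "card G = 0" | (single) "card G = 1" "k - 1 \<le> card H" | (full) "card H = k"
  proof (cases "\<exists>a b. a \<in> G \<and> b \<in> G \<and> a \<noteq> b")
    case True
    then obtain a b where ab: "a \<in> G" "b \<in> G" "a \<noteq> b" by blast
    have "c \<in> H" if "c \<in> {1..k}" for c
      using GH[OF ab(1) that] GH[OF ab(2) that] ab(3) by (cases "c = a") auto
    then have "{1..k} \<subseteq> H" by blast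
    from card_mono[OF fin(2) this] have "k \<le> card H" by simp
    then show thesis using le that(3) by simp
  next
    case False
    show thesis
    proof (cases "G = {}")
      case True
      then show thesis using that(1) by simp
    next
      case nonempty: False
      then obtain a where a: "G = {a}" using False by blast
      then have "{1..k} - {a} \<subseteq> H" "a \<in> {1..k}" using GH[of a] by (auto simp: G_def)
      then have "k - 1 \<le> card H" using card_mono[OF fin(2), of "{1..k} - {a}"] by simp
      then show thesis using that(2) a by simp
    qed
  qed
  note cases = this
  have h01: "0 \<le> h" "h \<le> 1" and g01: "0 \<le> g" "g \<le> 1"
    using le k0 by (auto simp: g_def h_def)
  have mid: "1/3 \<le> h - g" if "card G = 1" "k - 1 \<le> card H"
  proof -
    have "real k - 1 \<le> real (card H)" using that(2) by linarith
    then have "(real k - 2) / k \<le> (real (card H) - real (card G)) / k"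
      using that(1) by (intro divide_right_mono) auto
    then have "(real k - 2) / k \<le> h - g"
      by (simp only: g_def h_def diff_divide_distrib)
    moreover have "1/3 \<le> (real k - 2) / k" using k by (simp add: field_simps)
    ultimately show ?thesis by linarith
  qed
  show "0 \<le> \<Delta>"
    using cases
  proof cases
    case none
    then show ?thesis using h01 by (simp add: \<Delta> g_def)
  next
    case single
    then show ?thesis using mid by (simp add: \<Delta>)
  next
    case full
    then show ?thesis using g01 k0 by (simp add: \<Delta> h_def)
  qed
  assume t: "t \<in> {1/4..1/2}"
  define p where "p = (1 - t) * g + t * h"
  \<comment> \<open>In the three cases the variance is bounded by \<open>p\<close>, by
    \<open>1/4\<close> and by \<open>1 - p\<close> respectively.\<close>
  have "p - p\<^sup>2 \<le> \<Delta>"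
    using cases
  proof cases
    case none
    then have "p = t * h" by (simp add: p_def g_def)
    also have "\<dots> \<le> 1 * h" using t h01 by (intro mult_right_mono) auto
    finally have "p \<le> h" by simp
    then have "p - p\<^sup>2 \<le> h" using zero_le_power2[of p] by linarith
    then show ?thesis using none by (simp add: \<Delta> g_def)
  next
    case single
    have "0 \<le> (p - 1/2)\<^sup>2" by simp
    then have "p - p\<^sup>2 \<le> 1/4" by (simp add: power2_eq_square algebra_simps)
    then show ?thesis using mid[OF single] by (simp add: \<Delta>)
  next
    case full
    then have h: "h = 1" using k0 by (simp add: h_def)
    have "p - p\<^sup>2 = (1 - p) - (1 - p)\<^sup>2" by (simp add: power2_eq_square algebra_simps)
    also have "\<dots> \<le> 1 - p" by simp
    also have "\<dots> = (1 - t) * (1 - g)" by (simp add: p_def h algebra_simps)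
    also have "\<dots> \<le> 1 * (1 - g)" using t g01 by (intro mult_right_mono) auto
    finally show ?thesis by (simp add: \<Delta> h)
  qed
  then show "coord_avg (cell_weight k t) (cells k) i f x
      - (coord_avg (cell_weight k t) (cells k) i f x)\<^sup>2 \<le> \<Delta>"
    unfolding E p_def .
qed

section \<open>Symmetry and equality of influences\<close>

lemma upset_permutes:
  assumes "\<sigma> permutes {1..n}" "perm_vec \<sigma> ` A = A"
  shows "upset k n A (x \<circ> \<sigma>) = upset k n A x"
proof -
  have "(\<exists>y\<in>A. \<forall>i\<in>{1..n}. y i \<in> cell k ((x \<circ> \<sigma>) i))
      \<longleftrightarrow> (\<exists>y\<in>A. \<forall>i\<in>{1..n}. y (\<sigma> i) \<in> cell k (x (\<sigma> i)))"
    by (subst assms(2)[symmetric]) (simp add: perm_vec_def)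
  also have "\<dots> \<longleftrightarrow> (\<exists>y\<in>A. \<forall>i\<in>\<sigma> ` {1..n}. y i \<in> cell k (x i))" by simp
  finally show ?thesis unfolding permutes_image[OF assms(1)] upset_def by (simp only:)
qed

lemma coord_dev_permutes:
  assumes "\<sigma> permutes {1..n}" and f: "\<And>x. f (x \<circ> \<sigma>) = f x"
  shows "coord_dev w S j f (x \<circ> \<sigma>) = coord_dev w S (\<sigma> j) f x"
proof -
  have "(x \<circ> \<sigma>)(j := a) = x(\<sigma> j := a) \<circ> \<sigma>" for a
    using permutes_inj[OF assms(1)] by (auto simp: fun_eq_iff inj_eq)
  then show ?thesis using f by (simp add: coord_dev_def coord_avg_def)
qed

text \<open>Transitivity provides an automorphism carrying \<open>i\<close> to \<open>j\<close>. It
  preserves both the indicator and the product law, and so identifies the two influences.\<close>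

lemma influence_symmetric:
  assumes "symmetric_family n A" "i \<in> {1..n}" "j \<in> {1..n}" "finite S"
  shows "prod_avg w S n (\<lambda>x. (coord_dev w S i (upset k n A) x)\<^sup>2) x
    = prod_avg w S n (\<lambda>x. (coord_dev w S j (upset k n A) x)\<^sup>2) x"
proof -
  obtain \<sigma> where "\<sigma> \<in> family_Aut n A" and ij: "\<sigma> i = j"
    using assms(1-3) unfolding symmetric_family_iff by blast
  then have \<sigma>: "\<sigma> permutes {1..n}" "perm_vec \<sigma> ` A = A"
    by (auto simp: family_Aut_def sym_group_def)
  let ?f = "\<lambda>x. (coord_dev w S i (upset k n A) x)\<^sup>2"
  have "coord_dev w S i (upset k n A) y = coord_dev w S i (upset k n A) z"
    if "\<And>j. j \<in> {1..n} \<Longrightarrow> y j = z j" for y z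
  proof -
    have "upset k n A y = upset k n A z" "upset k n A (y(i := a)) = upset k n A (z(i := a))" for a
      using that by (auto intro!: upset_cong)
    then show ?thesis by (simp add: coord_dev_def coord_avg_def)
  qed
  then have "?f y = ?f z" if "\<And>j. j \<in> {1..n} \<Longrightarrow> y j = z j" for y z
    using that by metis
  then have "prod_avg w S n (\<lambda>x. ?f (x \<circ> \<sigma>)) x = prod_avg w S n ?f x"
    by (rule prod_avg_permutes[OF assms(4) \<sigma>(1)])
  moreover have "?f (y \<circ> \<sigma>) = (coord_dev w S j (upset k n A) y)\<^sup>2" for y
    using coord_dev_permutes[OF \<sigma>(1), of "upset k n A"] upset_permutes[OF \<sigma>] ij by metis
  ultimately show ?thesis by simp
qed

text \<open>At parameter \<open>1/2\<close> a singleton and its complement have equal weight, so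
  exchanging them preserves the law; the base point is exchanged too.\<close>

lemma prod_avg_cell_flip:
  defines "\<phi> \<equiv> \<lambda>p::bool \<times> nat. (\<not> fst p, snd p)"
  shows "prod_avg (cell_weight k (1/2)) (cells k) n (\<lambda>x. f (\<phi> \<circ> x)) x
    = prod_avg (cell_weight k (1/2)) (cells k) n f (\<phi> \<circ> x)"
proof (induction n arbitrary: x)
  case (Suc n)
  define z where "z = \<phi> \<circ> x"
  have upd: "\<phi> \<circ> (x(i := a)) = z(i := \<phi> a)" for i a by (auto simp: fun_eq_iff z_def)
  have "prod_avg (cell_weight k (1/2)) (cells k) (Suc n) (\<lambda>x. f (\<phi> \<circ> x)) x
      = (\<Sum>p\<in>cells k. cell_weight k (1/2) p *
          prod_avg (cell_weight k (1/2)) (cells k) n f (z(Suc n := \<phi> p)))"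
    unfolding prod_avg.simps coord_avg_def Suc upd ..
  also have "\<dots> = prod_avg (cell_weight k (1/2)) (cells k) (Suc n) f z"
    by (simp add: coord_avg_def sum_cells \<phi>_def cell_weight_def)
  finally show ?case unfolding z_def .
qed simp

lemma avg_upset_half:
  assumes "1 \<le> n" "A \<subseteq> grid k n" "intersecting n A" and k: "0 < k"
  shows "prod_avg (cell_weight k (1/2)) (cells k) n (upset k n A) x \<le> 1/2"
proof -
  define \<phi> where "\<phi> = (\<lambda>p::bool \<times> nat. (\<not> fst p, snd p))"
  let ?P = "prod_avg (cell_weight k (1/2)) (cells k) n"
  have "upset k n A y + upset k n A (\<phi> \<circ> y) \<le> 1" for y
  proof (rule ccontr)
    assume "\<not> ?thesis"
    then have "upset k n A y = 1" "upset k n A (\<phi> \<circ> y) = 1"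
      using upset_01[of k n A y] upset_01[of k n A "\<phi> \<circ> y"] by auto
    then obtain u v where uv: "u \<in> A" "\<forall>i\<in>{1..n}. u i \<in> cell k (y i)"
      "v \<in> A" "\<forall>i\<in>{1..n}. v i \<in> cell k (\<phi> (y i))"
      by (auto simp: upset_def split: if_splits)
    then obtain i where "i \<in> {1..n}" "u i = v i"
      using assms(3) unfolding intersecting_def by blast
    then show False using uv by (fastforce simp: \<phi>_def cell_def split: if_splits)
  qed
  then have "?P (\<lambda>x. upset k n A x + upset k n A (\<phi> \<circ> x)) x \<le> ?P (\<lambda>_. 1) x"
    by (intro prod_avg_mono) (auto simp: finite_cells cell_weight_def)
  also have "?P (\<lambda>_. 1) x = 1"
    using sum_cell_weight[OF k, of "1/2"]
    by (induction n arbitrary: x) (simp_all add: coord_avg_def)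
  finally have "?P (upset k n A) x + ?P (upset k n A) (\<phi> \<circ> x) \<le> 1"
    unfolding prod_avg_add \<phi>_def prod_avg_cell_flip .
  \<comment> \<open>The average overwrites every coordinate that \<open>upset\<close> reads, so the
    base point is immaterial.\<close>
  moreover have "?P (upset k n A) (\<phi> \<circ> x) = ?P (upset k n A) x"
    by (subst (1 2) prod_avg_eq_sum)
      (auto intro!: sum.cong arg_cong2[where f = "(*)"] upset_cong simp: override_on_def finite_cells)
  ultimately show ?thesis by simp
qed

text \<open>Each member of \<open>A\<close>, encoded by its singleton cells, contributes weight
  \<open>1 / k^n\<close>. Distinct members have distinct encodings, and the other terms are
  nonnegative.\<close>

lemma card_le_avg_upset:
  assumes A: "A \<subseteq> grid k n" and k: "0 < k"
  shows "real (card A) / real k ^ n \<le> prod_avg (cell_weight k 0) (cells k) n (upset k n A) x"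
proof -
  define \<iota> where "\<iota> y = restrict (\<lambda>i. (False, y i)) {1..n}" for y :: "nat \<Rightarrow> nat"
  have inj: "inj_on \<iota> A"
  proof (rule inj_onI)
    fix y z assume yz: "y \<in> A" "z \<in> A" and eq: "\<iota> y = \<iota> z"
    have "y i = z i" if "i \<in> {1..n}" for i
      using fun_cong[OF eq, of i] that by (simp add: \<iota>_def)
    then show "y = z" using yz A by (intro PiE_ext[of y "{1..n}" "\<lambda>_. {1..k}" z]) (auto simp: grid_def)
  qed
  have sub: "\<iota> ` A \<subseteq> {1..n} \<rightarrow>\<^sub>E cells k"
    using A by (fastforce simp: \<iota>_def grid_def cells_def)
  have val: "(\<Prod>i\<in>{1..n}. cell_weight k 0 (\<iota> y i)) * upset k n A (override_on x (\<iota> y) {1..n})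
      = 1 / real k ^ n" if "y \<in> A" for y
  proof -
    have "upset k n A (override_on x (\<iota> y) {1..n}) = 1"
      using that by (auto simp: upset_def \<iota>_def cell_def override_on_def)
    then show ?thesis by (simp add: \<iota>_def cell_weight_def power_one_over)
  qed
  have "real (card A) / real k ^ n = (\<Sum>y\<in>A. 1 / real k ^ n)" by simp
  also have "\<dots> = (\<Sum>z\<in>\<iota> ` A. (\<Prod>i\<in>{1..n}. cell_weight k 0 (z i))
      * upset k n A (override_on x z {1..n}))"
    using val by (simp add: sum.reindex[OF inj])
  also have "\<dots> \<le> prod_avg (cell_weight k 0) (cells k) n (upset k n A) x"
    unfolding prod_avg_eq_sum[OF finite_cells]
    using sub by (intro sum_mono2 finite_PiE)
      (auto simp: finite_cells intro!: mult_nonneg_nonneg prod_nonneg simp: cell_weight_def upset_def)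
  finally show ?thesis .
qed

section \<open>The differential inequality and its integration\<close>

lemma avg_upset_bound:
  assumes k: "3 \<le> k" and n: "1 \<le> n" and A: "A \<subseteq> grid k n"
    and sym: "symmetric_family n A" and int: "intersecting n A"
  shows "real (card A) / real k ^ n \<le> real n powr (- (1 / 128) / real k)"
proof -
  define F where "F t = prod_avg (cell_weight k t) (cells k) n (upset k n A) (\<lambda>_. (False, 1))" for t
  define w' :: "bool \<times> nat \<Rightarrow> real" where "w' p = (if fst p then 1 else - 1) / real k" for p
  define F' where "F' t = (\<Sum>i<n. prod_avg (cell_weight k t) (cells k) n
    (coord_avg w' (cells k) (Suc i) (upset k n A)) (\<lambda>_. (False, 1)))" for t
  have k0: "0 < k" and fin: "finite (cells k)" using k by (auto simp: finite_cells)
  have deriv: "(F has_real_derivative F' t) (at t)" for t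
    unfolding F_def F'_def
  proof (rule DERIV_prod_avg[OF fin sum_cell_weight[OF k0]])
    fix p show "((\<lambda>t. cell_weight k t p) has_real_derivative w' p) (at t)"
      by (use k0 in \<open>auto simp: cell_weight_def w'_def intro!: derivative_eq_intros\<close>)
  qed
  have const: "prod_avg (cell_weight k t) (cells k) n (\<lambda>_. 0) x = 0" for t x
    using prod_avg_cmult[of "cell_weight k t" "cells k" n 0 "\<lambda>_. 0"] by simp
  \<comment> \<open>Monotonicity is needed down to \<open>t = 0\<close>, outside the range where the
    atoms are bounded below.\<close>
  have F'_nonneg: "0 \<le> F' t" if "t \<in> {0..1}" for t
    unfolding F'_def
  proof (rule sum_nonneg)
    fix i
    have "prod_avg (cell_weight k t) (cells k) n (\<lambda>_. 0) (\<lambda>_. (False, 1))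
        \<le> prod_avg (cell_weight k t) (cells k) n
          (coord_avg w' (cells k) (Suc i) (upset k n A)) (\<lambda>_. (False, 1))"
      unfolding w'_def
      using that by (intro prod_avg_mono upset_fibre(1)[OF k] fin) (auto simp: cell_weight_def)
    then show "0 \<le> prod_avg (cell_weight k t) (cells k) n
        (coord_avg w' (cells k) (Suc i) (upset k n A)) (\<lambda>_. (False, 1))"
      by (simp only: const)
  qed
  have F_mono: "F s \<le> F t" if "0 \<le> s" "s \<le> t" "t \<le> 1" for s t
  proof (rule DERIV_nonneg_imp_nondecreasing[OF that(2)])
    fix u assume "s \<le> u" "u \<le> t"
    then have "0 \<le> F' u" using that by (intro F'_nonneg) auto
    then show "\<exists>y. (F has_real_derivative y) (at u) \<and> 0 \<le> y" using deriv by blast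
  qed
  have half: "F (1/2) \<le> 1/2"
    unfolding F_def by (rule avg_upset_half[OF n A int k0])
  have F0: "real (card A) / real k ^ n \<le> F 0"
    unfolding F_def by (rule card_le_avg_upset[OF A k0])
  have "0 \<le> real (card A) / real k ^ n" by simp
  then have F_nonneg: "0 \<le> F 0" using F0 by (rule order_trans)
  \<comment> \<open>\<open>influence_bool\<close> with \<open>\<alpha> = 1 / (4 * k)\<close> gives
    the factor \<open>1 / (16 * k)\<close>; it is halved because \<open>1 - F t \<ge> 1/2\<close> up
    to \<open>t = 1/2\<close>.\<close>
  define c where "c = ln (real n) / (32 * real k)"
  have growth: "c * F t \<le> F' t" if t: "t \<in> {1/4..1/2}" for t
  proof -
    interpret atomic_weights "cell_weight k t" "cells k" "1 / (4 * real k)"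
      using k t by (rule atomic_cell_weight)
    define I where "I i = P n (\<lambda>x. (D (Suc i) (upset k n A) x)\<^sup>2) (\<lambda>_. (False, 1))" for i
    have I0: "I i = I 0" if "i < n" for i
      unfolding I_def using that n by (intro influence_symmetric[OF sym] fin) auto
    define J where "J = (\<Sum>j<n. I j)"
    have "J = (\<Sum>j<n. I 0)" unfolding J_def by (intro sum.cong refl I0) simp
    then have I_eq: "I i = J / real n" if "i < n" for i
      using I0[OF that] n by simp
    have "1 / (4 * real k) / 4 * (F t * (1 - F t)) * ln (real n) \<le> J"
      unfolding F_def by (rule influence_bool[OF upset_01 n I_eq[unfolded I_def]])
    \<comment> \<open>Fibre by fibre, the conditional variance is at most the corresponding term of
      the derivative.\<close>
    also have "\<dots> \<le> F' t"
      unfolding F'_def J_def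
    proof (rule sum_mono)
      fix i assume i: "i \<in> {..<n}"
      have "I i = P n (E (Suc i) (\<lambda>x. (D (Suc i) (upset k n A) x)\<^sup>2)) (\<lambda>_. (False, 1))"
        unfolding I_def using i by (subst P_E) auto
      also have "\<dots> \<le> P n (coord_avg w' (cells k) (Suc i) (upset k n A)) (\<lambda>_. (False, 1))"
        unfolding E_dev_sq_bool[OF upset_01] w'_def
        by (intro P_mono upset_fibre(2)[OF k t])
      finally show "I i \<le> P n (coord_avg w' (cells k) (Suc i) (upset k n A)) (\<lambda>_. (False, 1))" .
    qed
    finally have "(F t * (1 - F t)) * (ln (real n) / (16 * real k)) \<le> F' t"
      by (simp add: field_simps)
    moreover have "F t * (1/2) \<le> F t * (1 - F t)"
      using F_mono[of 0 t] F_mono[of t "1/2"] t F_nonneg half by (intro mult_left_mono) auto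
    then have "F t * (1/2) * (ln (real n) / (16 * real k)) \<le> (F t * (1 - F t)) * (ln (real n) / (16 * real k))"
      using n by (intro mult_right_mono) auto
    ultimately show ?thesis by (simp add: c_def mult.commute)
  qed
  have "real (card A) / real k ^ n \<le> F (1/4)"
    using F0 F_mono[of 0 "1/4"] by simp
  \<comment> \<open>The interval has length \<open>1/4\<close>, so the exponent is
    \<open>- ln n / (128 * k)\<close>; this is the origin of \<open>1/128\<close>.\<close>
  also have "\<dots> \<le> F (1/2) * exp (- c * (1/2 - 1/4))"
    using growth deriv by (intro gronwall_backward) auto
  also have "\<dots> \<le> 1 * exp (- c * (1/2 - 1/4))"
    using half by (intro mult_right_mono) auto
  also have "\<dots> = real n powr (- (1 / 128) / real k)"
    using n by (simp add: powr_def c_def)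
  finally show ?thesis .
qed

theorem theorem1p1:
  shows "\<exists>c::real. c > 0 \<and>
    (\<forall>k::nat. k \<ge> 3 \<longrightarrow>
      (\<exists>K::real. K > 0 \<and>
        (\<forall>(n::nat) (A :: (nat \<Rightarrow> nat) set).
          n \<ge> 1 \<longrightarrow> A \<subseteq> grid k n \<longrightarrow> symmetric_family n A \<longrightarrow> intersecting n A \<longrightarrow>
            real (card A) \<le> K * (real k ^ n / real n powr (c / real k)))))"
proof (rule exI[of _ "1/128"], intro conjI allI impI)
  fix k :: nat assume k: "3 \<le> k"
  have "real (card A) \<le> 1 * (real k ^ n / real n powr (1 / 128 / real k))"
    if "1 \<le> n" "A \<subseteq> grid k n" "symmetric_family n A" "intersecting n A" for n A
  proof -
    have "real (card A) / real k ^ n \<le> real n powr (- (1 / 128) / real k)"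
      using k that by (rule avg_upset_bound)
    then show ?thesis using k that(1) by (simp add: powr_minus field_simps)
  qed
  then show "\<exists>K::real. K > 0 \<and> (\<forall>(n::nat) (A :: (nat \<Rightarrow> nat) set).
      n \<ge> 1 \<longrightarrow> A \<subseteq> grid k n \<longrightarrow> symmetric_family n A \<longrightarrow> intersecting n A \<longrightarrow>
        real (card A) \<le> K * (real k ^ n / real n powr (1 / 128 / real k)))"
    by (intro exI[of _ 1]) auto
qed simp

end
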